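(* Let $k\ge 3$, $0\le\alpha<1$, let $G$ be a connected $k$-uniform hypergraph, let $u,v$ be two (not necessarily distinct) non-pendant vertices of $G$, and let $s\ge 0$ be an integer. Suppose that for all integers $p\ge q\ge 1$ the hypergraph $G_{u,v}(p,q)$ has an internal path of length $s$ between $u$ and $v$ (where $s=0$ means $u=v$). Then for all integers $p\ge q\ge 1$ with $p-q+1\ge s$, $$\rho_\alpha(G_{u,v}(p+1,q-1))<\rho_\alpha(G_{u,v}(p,q)).$$
   Context: A $k$-uniform hypergraph $G=(V(G),E(G))$ has a finite vertex set and an edge set that is a collection of $k$-subsets of $V(G)$ (no repeated edges). The degree $\deg_G(v)$ is the number of edges containing $v$; $v$ is pendant if $\deg_G(v)=1$ and non-pendant otherwise (here: degree at least 2). Spectral notation: with $V(G)=\{1,\dots,n\}$, the tensor $\mathcal A_\alpha(G)=\alpha\mathcal D(G)+(1-\alpha)\mathcal A(G)$, where $\mathcal D(G)$ is the diagonal tensor of order $k$ and dimension $n$ with the vertex degrees on the diagonal and $\mathcal A(G)$ is the adjacency tensor of order $k$ and dimension $n$ with entries $a_{i_1\dots i_k}=\frac1{(k-1)!}$ if $\{i_1,\dots,i_k\}\in E(G)$ and $0$ otherwise. Equivalently $(\mathcal A_\alpha(G)\boldsymbol x)_v=\alpha \deg_G(v)x_v^{k-1}+(1-\alpha)\sum_{e\ni v}\prod_{w\in e\setminus\{v\}}x_w$. An eigenvalue is $\lambda\in\mathbb C$ for which there is a nonzero $\boldsymbol x\in\mathbb C^n$ with $\mathcal A_\alpha(G)\boldsymbol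 x=\lambda \boldsymbol x^{[k-1]}$, where $\boldsymbol x^{[k-1]}=(x_i^{k-1})_i$. The $\alpha$-spectral radius $\rho_\alpha(G)$ is the largest modulus of an eigenvalue of $\mathcal A_\alpha(G)$. A loose path of length $d$ is a $k$-uniform hypergraph consisting of distinct edges $e_1,\dots,e_d$ with $|e_i\cap e_j|=1$ if $|i-j|=1$ and $e_i\cap e_j=\varnothing$ if $|i-j|\ge 2$; it is written $v_0e_1v_1\dots e_dv_d$, where $e_i\cap e_{i+1}=\{v_i\}$ for $1\le i\le d-1$, $v_0\in e_1\setminus\{v_1\}$, $v_d\in e_d\setminus\{v_{d-1}\}$ (and $v_0\neq v_1$ if $d=1$); $v_0,v_d$ are its end vertices. A loose path of length $0$ is a single vertex. $G_{u,v}(p,q)$ is the hypergraph obtained from $G$ by attaching a new loose path of length $p$ at $u$ (identifying one end vertex of the path with $u$) and a new loose path of length $q$ at $v$ (identifying one end vertex with $v$), all other vertices of the two paths being new and distinct. An internal path of a hypergraph $H$ between $u$ and $v$ is a loose path $\mathbb P$ in $H$ from $u$ to $v$ such that $\deg_H(u),\deg_H(v)\ge 3$ and $\deg_H(w)=\deg_{\mathbb P}(w)$ for every $w\in V(\mathbb P)\setminus\{u,v\}$. *)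

theory Defs
  imports Complex_Main
begin

datatype 'a hypergraph = Hypergraph (verts: "'a set") (edges: "'a set set")

definition uniform_hypergraph :: "nat \<Rightarrow> 'a hypergraph \<Rightarrow> bool" where
  "uniform_hypergraph k G \<longleftrightarrow>
     finite (verts G) \<and> (\<forall>e\<in>edges G. e \<subseteq> verts G \<and> card e = k)"

definition vertex_degree :: "'a hypergraph \<Rightarrow> 'a \<Rightarrow> nat" where
  "vertex_degree G v = card {e \<in> edges G. v \<in> e}"

definition connected_hypergraph :: "'a hypergraph \<Rightarrow> bool" where
  "connected_hypergraph G \<longleftrightarrow>
     (\<forall>x\<in>verts G. \<forall>y\<in>verts G. (x, y) \<in> {(a, b). \<exists>e\<in>edges G. a \<in> e \<and> b \<in> e}\<^sup>*)"


section \<open>Tensors and the alpha-spectral radius\<close>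

text \<open>
  A real tensor of order \<open>k\<close> indexed by a finite set \<open>V\<close> is a function on lists; only its values
  on lists of length \<open>k\<close> over \<open>V\<close> matter. Likewise a vector is a function of which
  only the values on \<open>V\<close> matter.
\<close>

type_synonym 'a tensor = "'a list \<Rightarrow> real"

definition degree_tensor :: "nat \<Rightarrow> 'a hypergraph \<Rightarrow> 'a tensor" where
  "degree_tensor k G is = (if is = replicate k (hd is) then real (vertex_degree G (hd is)) else 0)"

text \<open>
  If \<open>G\<close> is \<open>k\<close>-uniform and \<open>is\<close> has length \<open>k\<close>, then \<open>set is \<in> edges G\<close> forces the
  indices in \<open>is\<close> to be pairwise distinct.
\<close>

definition adjacency_tensor :: "nat \<Rightarrow> 'a hypergraph \<Rightarrow> 'a tensor" where
  "adjacency_tensor k G is = (if set is \<in> edges G then 1 / fact (k - 1) else 0)"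

definition alpha_tensor :: "nat \<Rightarrow> real \<Rightarrow> 'a hypergraph \<Rightarrow> 'a tensor" where
  "alpha_tensor k \<alpha> G is = \<alpha> * degree_tensor k G is + (1 - \<alpha>) * adjacency_tensor k G is"

text \<open>
  \<open>(T x)\<^sub>v\<close> is the sum of \<open>T\<^sub>v\<^sub>,\<^sub>i \<cdot> x\<^sub>i\<close> over all \<open>(k - 1)\<close>-tuples \<open>i\<close> of indices, where
  \<open>x\<^sub>i\<close> is the product of the entries of \<open>x\<close> at the members of the tuple.
\<close>

definition tensor_apply ::
    "nat \<Rightarrow> 'a set \<Rightarrow> 'a tensor \<Rightarrow> ('a \<Rightarrow> complex) \<Rightarrow> 'a \<Rightarrow> complex" where
  "tensor_apply k V T x v =
     (\<Sum>is | set is \<subseteq> V \<and> length is = k - 1. of_real (T (v # is)) * prod_list (map x is))"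

definition tensor_eigenvalue :: "nat \<Rightarrow> 'a set \<Rightarrow> 'a tensor \<Rightarrow> complex \<Rightarrow> bool" where
  "tensor_eigenvalue k V T l \<longleftrightarrow>
     (\<exists>x. (\<exists>v\<in>V. x v \<noteq> 0) \<and> (\<forall>v\<in>V. tensor_apply k V T x v = l * x v ^ (k - 1)))"

text \<open>
  A tensor of order at least 2 on a finite nonempty index set has at least one and finitely many
  eigenvalues, so the supremum below is the largest modulus of an eigenvalue.
\<close>

definition alpha_spectral_radius :: "nat \<Rightarrow> real \<Rightarrow> 'a hypergraph \<Rightarrow> real" where
  "alpha_spectral_radius k \<alpha> G =
     Sup {cmod l | l. tensor_eigenvalue k (verts G) (alpha_tensor k \<alpha> G) l}"


section \<open>Loose paths and internal paths\<close>

text \<open>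
  The loose path \<open>v\<^sub>0 e\<^sub>1 v\<^sub>1 \<dots> e\<^sub>d v\<^sub>d\<close> is given by \<open>vs = [v\<^sub>0, \<dots>, v\<^sub>d]\<close> and
  \<open>es = [e\<^sub>1, \<dots>, e\<^sub>d]\<close>; thus \<open>es ! i\<close> is the edge \<open>e\<close> with index \<open>i + 1\<close>, while \<open>vs ! i\<close> is
  the vertex \<open>v\<^sub>i\<close>. Its length is \<open>length es\<close>.
\<close>

definition loose_path :: "nat \<Rightarrow> 'a list \<Rightarrow> 'a set list \<Rightarrow> bool" where
  "loose_path k vs es \<longleftrightarrow>
     length vs = length es + 1 \<and> distinct es \<and> (\<forall>e\<in>set es. card e = k) \<and>
     (\<forall>i. i + 1 < length es \<longrightarrow> es ! i \<inter> es ! (i + 1) = {vs ! (i + 1)}) \<and>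
     (\<forall>i j. i + 2 \<le> j \<and> j < length es \<longrightarrow> es ! i \<inter> es ! j = {}) \<and>
     (es \<noteq> [] \<longrightarrow>
        vs ! 0 \<in> es ! 0 - {vs ! 1} \<and>
        vs ! length es \<in> es ! (length es - 1) - {vs ! (length es - 1)})"

text \<open>
  \<open>set vs\<close> only contributes a vertex outside \<open>\<Union>(set es)\<close> when the path has length 0.
\<close>

definition path_hypergraph :: "'a list \<Rightarrow> 'a set list \<Rightarrow> 'a hypergraph" where
  "path_hypergraph vs es = Hypergraph (set vs \<union> \<Union>(set es)) (set es)"

definition internal_path ::
    "nat \<Rightarrow> 'a hypergraph \<Rightarrow> 'a \<Rightarrow> 'a \<Rightarrow> 'a list \<Rightarrow> 'a set list \<Rightarrow> bool" where
  "internal_path k H u v vs es \<longleftrightarrow>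
     loose_path k vs es \<and> hd vs = u \<and> last vs = v \<and>
     verts (path_hypergraph vs es) \<subseteq> verts H \<and> edges (path_hypergraph vs es) \<subseteq> edges H \<and>
     vertex_degree H u \<ge> 3 \<and> vertex_degree H v \<ge> 3 \<and>
     (\<forall>w \<in> verts (path_hypergraph vs es) - {u, v}.
        vertex_degree H w = vertex_degree (path_hypergraph vs es) w)"


section \<open>Attaching loose paths\<close>

text \<open>
  Vertices of \<open>G\<^sub>u\<^sub>,\<^sub>v(p,q)\<close>: \<open>Orig x\<close> is the vertex \<open>x\<close> of \<open>G\<close>. For \<open>j < k - 1\<close>, the vertices
  \<open>PathU i j\<close> (respectively \<open>PathV i j\<close>) are the \<open>k - 1\<close> new vertices lying in the \<open>i\<close>-th edge of
  the path attached at \<open>u\<close> (respectively \<open>v\<close>) but not in an earlier edge, \<open>i = 1, 2, \<dots>\<close>; the one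
  with \<open>j = 0\<close> is shared with the edge \<open>i + 1\<close> if there is one. The argument \<open>c\<close> below is
  \<open>PathU\<close> or \<open>PathV\<close>.
\<close>

datatype 'a attached = Orig 'a | PathU nat nat | PathV nat nat

definition branch_vertex :: "(nat \<Rightarrow> nat \<Rightarrow> 'a attached) \<Rightarrow> 'a \<Rightarrow> nat \<Rightarrow> 'a attached" where
  "branch_vertex c w i = (if i = 0 then Orig w else c i 0)"

definition branch_edge ::
    "nat \<Rightarrow> (nat \<Rightarrow> nat \<Rightarrow> 'a attached) \<Rightarrow> 'a \<Rightarrow> nat \<Rightarrow> 'a attached set" where
  "branch_edge k c w i = insert (branch_vertex c w (i - 1)) (c i ` {..<k - 1})"

definition attach_paths ::
    "nat \<Rightarrow> 'a hypergraph \<Rightarrow> 'a \<Rightarrow> 'a \<Rightarrow> nat \<Rightarrow> nat \<Rightarrow> 'a attached hypergraph" where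
  "attach_paths k G u v p q = Hypergraph
     (Orig ` verts G \<union> {PathU i j | i j. i \<in> {1..p} \<and> j < k - 1}
                     \<union> {PathV i j | i j. i \<in> {1..q} \<and> j < k - 1})
     ((\<lambda>e. Orig ` e) ` edges G \<union> branch_edge k PathU u ` {1..p} \<union> branch_edge k PathV v ` {1..q})"

lemma loose_path_branch:
  assumes "k \<ge> 2" and "c = PathU \<or> c = PathV"
  shows "loose_path k (map (branch_vertex c w) [0..<p + 1]) (map (branch_edge k c w) [1..<p + 1])"
proof -
  have inj: "c i j = c i' j' \<longleftrightarrow> i = i' \<and> j = j'" for i j i' j'
    using assms(2) by auto
  have new: "c i j \<noteq> Orig x" "Orig x \<noteq> c i j" for i j x
    using assms(2) by auto
  note defs = branch_edge_def branch_vertex_def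
  have card: "card (branch_edge k c w i) = k" if "i \<ge> 1" for i
  proof -
    have "card (c i ` {..<k - 1}) = k - 1"
      by (subst card_image) (auto simp: inj_on_def inj)
    moreover have "branch_vertex c w (i - 1) \<notin> c i ` {..<k - 1}"
      using that by (auto simp: defs inj new)
    ultimately show ?thesis
      using assms(1) by (simp add: branch_edge_def)
  qed
  have "inj_on (branch_edge k c w) {1..<p + 1}"
  proof (rule linorder_inj_onI)
    fix i j assume "i < j" "i \<in> {1..<p + 1}" "j \<in> {1..<p + 1}"
    then have "c j 0 \<in> branch_edge k c w j" "c j 0 \<notin> branch_edge k c w i"
      using assms(1) by (auto simp: defs inj new)
    then show "branch_edge k c w i \<noteq> branch_edge k c w j" by metis
  qed auto
  then have dist: "distinct (map (branch_edge k c w) [1..<p + 1])"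
    by (simp only: distinct_map distinct_upt set_upt simp_thms)
  have adj: "branch_edge k c w (i + 1) \<inter> branch_edge k c w (i + 2) = {branch_vertex c w (i + 1)}" for i
    using assms(1) by (auto simp: defs inj new)
  have disj: "branch_edge k c w (i + 1) \<inter> branch_edge k c w (j + 1) = {}" if "i + 2 \<le> j" for i j
    using that by (auto simp: defs inj new)
  have ends: "branch_vertex c w i \<in> branch_edge k c w (i + 1) - {branch_vertex c w (i + 1)}"
    "branch_vertex c w (i + 1) \<in> branch_edge k c w (i + 1) - {branch_vertex c w i}" for i
    using assms(1) by (auto simp: defs inj new)
  show ?thesis
    unfolding loose_path_def
  proof (intro conjI allI impI)
    show "distinct (map (branch_edge k c w) [1..<p + 1])" by (fact dist)
  qed (use card adj disj ends[of 0] ends[of "p - 1"] in \<open>auto simp del: upt_Suc simp: nth_append\<close>)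
qed

lemma uniform_attach_paths:
  assumes G: "uniform_hypergraph k G" and k: "k \<ge> 2" and uv: "u \<in> verts G" "v \<in> verts G"
  shows "uniform_hypergraph k (attach_paths k G u v p q)"
proof -
  have card: "card (branch_edge k c w i) = k"
    if "c = PathU \<or> c = PathV" "i \<ge> 1" for c :: "nat \<Rightarrow> nat \<Rightarrow> 'a attached" and w i
  proof -
    have "branch_edge k c w i \<in> set (map (branch_edge k c w) [1..<i + 1])"
      using that(2) by auto
    then show ?thesis
      using loose_path_branch[OF k that(1), of w i] unfolding loose_path_def by blast
  qed
  have fin: "finite {c i j | i j. i \<in> {1..r} \<and> j < k - 1}"
    for c :: "nat \<Rightarrow> nat \<Rightarrow> 'a attached" and r
  proof -
    have "{c i j | i j. i \<in> {1..r} \<and> j < k - 1} = (\<lambda>(i, j). c i j) ` ({1..r} \<times> {..<k - 1})"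
      by fastforce
    then show ?thesis by simp
  qed
  have sub: "branch_edge k c w i \<subseteq> insert (Orig w) {c i j | i j. i \<in> {1..r} \<and> j < k - 1}"
    if i: "i \<in> {1..r}" for c :: "nat \<Rightarrow> nat \<Rightarrow> 'a attached" and w i r
  proof -
    have "branch_vertex c w (i - 1) = Orig w \<or>
        branch_vertex c w (i - 1) = c (i - 1) 0 \<and> i - 1 \<in> {1..r} \<and> 0 < k - 1"
      using i k by (auto simp: branch_vertex_def)
    then show ?thesis
      using i unfolding branch_edge_def by blast
  qed
  have orig: "Orig ` e \<subseteq> Orig ` verts G \<and> card (Orig ` e) = k" if "e \<in> edges G" for e
    using that G by (simp add: card_image inj_on_def uniform_hypergraph_def image_mono)
  let ?H = "attach_paths k G u v p q"
  have "finite (verts ?H)"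
    using G fin by (simp add: attach_paths_def uniform_hypergraph_def del: One_nat_def)
  moreover have "e \<subseteq> verts ?H \<and> card e = k" if e: "e \<in> edges ?H" for e
  proof -
    consider (G) f where "f \<in> edges G" "e = Orig ` f"
      | (U) i where "i \<in> {1..p}" "e = branch_edge k PathU u i"
      | (V) i where "i \<in> {1..q}" "e = branch_edge k PathV v i"
      using e unfolding attach_paths_def hypergraph.sel by blast
    then show ?thesis
    proof cases
      case G
      then show ?thesis
        using orig[of f] unfolding attach_paths_def hypergraph.sel by blast
    next
      case U
      then show ?thesis
        using sub[OF U(1), of PathU u] card[of PathU i u] uv(1)
        unfolding attach_paths_def hypergraph.sel by auto
    next
      case V
      then show ?thesis
        using sub[OF V(1), of PathV v] card[of PathV i v] uv(2)
        unfolding attach_paths_def hypergraph.sel by auto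
    qed
  qed
  ultimately show ?thesis
    unfolding uniform_hypergraph_def by blast
qed

end

theory Submission
  imports Defs "HOL-Analysis.Analysis" "HOL-Combinatorics.Multiset_Permutations"
begin

text \<open>
  Both hypergraphs arise from \<open>C = G\<^sub>u\<^sub>,\<^sub>v(p, q - 1)\<close> by hanging one more edge on an end
  of a long loose path of \<open>C\<close>: the one that runs from the end of the path at \<open>v\<close> through \<open>v\<close>, the
  internal path and \<open>u\<close> to the end of the path at \<open>u\<close>. The reflection of this long path about its
  centre swaps the two places where the edge is hung, and \<open>p - q + 1 \<ge> s\<close> says that neither \<open>v\<close> nor
  \<open>u\<close> lies beyond the centre. Take the Perron vector of \<open>G\<^sub>u\<^sub>,\<^sub>v(p + 1, q - 1)\<close>
  and move, for each pair of mirrored vertices, the larger entry to the side of \<open>v\<close>. This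
  two-point rearrangement preserves the norm and does not decrease the form
  \<open>\<Sum>\<^sub>e (\<alpha> \<Sum>\<^sub>w\<^sub>\<in>\<^sub>e x\<^sub>w\<^sup>k + (1 - \<alpha>) k \<Prod>\<^sub>w\<^sub>\<in>\<^sub>e x\<^sub>w)\<close>,
  whose maximum on the unit sphere is the spectral radius. In the case of equality the rearranged
  vector is an eigenvector too, which the eigenvalue equations between \<open>v\<close> and the place of the new
  edge refute.
\<close>

section \<open>The form of the alpha tensor\<close>

text \<open>The bound on \<open>p - q\<close> is needed because an edge off the long path has no
  mirror image that could make up for a loss: its vertices must keep or raise their entries. Such an
  edge meets the long path only at \<open>v\<close> or \<open>u\<close>; its other vertices are
  fixed by the reflection. Let the path at \<open>v\<close> in \<open>C\<close> have
  \<open>q\<close> edges, one fewer than in the statement. The long path then has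
  \<open>q + s + p\<close> edges, with \<open>v\<close> at position \<open>q\<close> and
  \<open>u\<close> at \<open>q + s\<close>: from \<open>q + s \<le> p\<close>, \<open>u\<close> is
  at the latest on the centre, and from \<open>q < p\<close>, \<open>v\<close> is strictly before
  it.

  Strictness is the obstacle, since the rearrangement may leave the form unchanged. The degree of
  \<open>v\<close> provides an edge of \<open>G\<close> at \<open>v\<close> off the long path; in
  the case of equality its energy cannot grow, so the entry at \<open>v\<close> is kept, and this
  starts the propagation.

  The spectral radius is reached by maximization over nonnegative vectors: compactness gives a
  maximizer, connectedness makes it positive, the derivative in each coordinate gives the eigenvalue
  equations, and the moduli of complex eigenvectors show that no eigenvalue is larger.\<close>

definition edge_energy :: "real \<Rightarrow> nat \<Rightarrow> ('b \<Rightarrow> real) \<Rightarrow> 'b set \<Rightarrow> real" where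
  "edge_energy \<alpha> k x e = \<alpha> * (\<Sum>w\<in>e. x w ^ k) + (1 - \<alpha>) * (real k * (\<Prod>w\<in>e. x w))"

definition energy :: "real \<Rightarrow> nat \<Rightarrow> 'b set set \<Rightarrow> ('b \<Rightarrow> real) \<Rightarrow> real" where
  "energy \<alpha> k E x = sum (edge_energy \<alpha> k x) E"

text \<open>Generic in the field, since eigenvectors are complex while the variational argument is
  real. The diagonal term stands inside the sum over the edges at \<open>v\<close>, so that
  contributions can be compared edge by edge.\<close>

definition vertex_form ::
    "real \<Rightarrow> nat \<Rightarrow> 'b set set \<Rightarrow> ('b \<Rightarrow> 'c::real_field) \<Rightarrow> 'b \<Rightarrow> 'c" where
  "vertex_form \<alpha> k E x v =
     (\<Sum>e | e \<in> E \<and> v \<in> e. of_real \<alpha> * x v ^ (k - 1) + of_real (1 - \<alpha>) * (\<Prod>w\<in>e - {v}. x w))"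

lemma finite_edges:
  assumes "uniform_hypergraph k G"
  shows "finite (edges G)"
  using assms finite_subset[of "edges G" "Pow (verts G)"]
  unfolding uniform_hypergraph_def by blast

text \<open>Only \<open>k - 1\<close> entries are there to supply the other \<open>k - 1\<close>
  vertices of \<open>e\<close>, so none can be repeated and none can be spent on
  \<open>v\<close>.\<close>

lemma tuples_of_edge:
  assumes "card e = k" "k \<ge> 1" "v \<in> e"
  shows "{is. length is = k - 1 \<and> insert v (set is) = e} = permutations_of_set (e - {v})"
    (is "?L = ?R")
proof (intro set_eqI iffI)
  have fin: "finite e" using assms card_ge_0_finite[of e] by simp
  fix js
  {
    assume "js \<in> ?L"
    then have l: "length js = k - 1" and s: "insert v (set js) = e" by auto
    have "card (set js) \<le> k - 1" using l card_length[of js] by simp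
    then have "v \<notin> set js"
      using s assms by (auto simp: insert_absorb)
    then have "set js = e - {v}" using s by auto
    moreover have "card (e - {v}) = k - 1" using assms fin by simp
    ultimately show "js \<in> ?R" using l by (auto simp: permutations_of_set_def card_distinct)
  }
  assume "js \<in> ?R"
  then show "js \<in> ?L"
    using assms fin
    by (auto simp: permutations_of_set_def distinct_card[symmetric])
qed

text \<open>The diagonal part sees only the constant tuple. In the adjacency part the tuples are
  grouped by the edge they form with \<open>v\<close>; each edge collects \<open>(k - 1)!\<close>
  equal products, which cancels the factorial in the tensor.\<close>

lemma tensor_apply_alpha_tensor:
  assumes G: "uniform_hypergraph k G" and k: "k \<ge> 1" and v: "v \<in> verts G"
  shows "tensor_apply k (verts G) (alpha_tensor k \<alpha> G) x v = vertex_form \<alpha> k (edges G) x v"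
proof -
  let ?V = "verts G"
  define T where "T = {is. set is \<subseteq> ?V \<and> length is = k - 1}"
  define S where "S = {e \<in> edges G. v \<in> e}"
  have finV: "finite ?V" using G by (simp add: uniform_hypergraph_def)
  have finT: "finite T"
    unfolding T_def using finite_lists_length_eq[OF finV] .
  have finS: "finite S" unfolding S_def using finite_edges[OF G] by simp
  have deg: "(\<Sum>is\<in>T. of_real (degree_tensor k G (v # is)) * prod_list (map x is))
      = of_nat (vertex_degree G v) * x v ^ (k - 1)"
  proof -
    have "v # is = replicate k v \<longleftrightarrow> is = replicate (k - 1) v" for "is"
      using k by (cases k) auto
    then have "(\<Sum>is\<in>T. of_real (degree_tensor k G (v # is)) * prod_list (map x is))
       = (\<Sum>is\<in>T. if is = replicate (k - 1) v
             then of_nat (vertex_degree G v) * prod_list (map x is) else 0)"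
      by (intro sum.cong) (auto simp: degree_tensor_def)
    also have "\<dots> = of_nat (vertex_degree G v) * prod_list (map x (replicate (k - 1) v))"
      using finT v by (simp add: T_def set_replicate_conv_if)
    finally show ?thesis by simp
  qed
  have adj: "(\<Sum>is\<in>T. of_real (adjacency_tensor k G (v # is)) * prod_list (map x is))
      = (\<Sum>e\<in>S. \<Prod>w\<in>e - {v}. x w)"
  proof -
    have 1: "(\<Union>e\<in>S. permutations_of_set (e - {v})) = {is \<in> T. insert v (set is) \<in> edges G}"
    proof -
      have "permutations_of_set (e - {v}) = {is. length is = k - 1 \<and> insert v (set is) = e}"
        if "e \<in> S" for e
        using that tuples_of_edge[of e k v] G k unfolding S_def uniform_hypergraph_def by auto
      then have "(\<Union>e\<in>S. permutations_of_set (e - {v}))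
          = (\<Union>e\<in>S. {is. length is = k - 1 \<and> insert v (set is) = e})"
        by simp
      also have "\<dots> = {is \<in> T. insert v (set is) \<in> edges G}"
        using G unfolding S_def T_def uniform_hypergraph_def by fastforce
      finally show ?thesis .
    qed
    have 2: "(\<Sum>is\<in>permutations_of_set (e - {v}). prod_list (map x is) / fact (k - 1))
        = (\<Prod>w\<in>e - {v}. x w)" if "e \<in> S" for e
    proof -
      have c: "card (e - {v}) = k - 1" "finite (e - {v})"
        using that G finV finite_subset[of e ?V] unfolding S_def uniform_hypergraph_def by auto
      have "(\<Sum>is\<in>permutations_of_set (e - {v}). prod_list (map x is) / fact (k - 1))
          = (\<Sum>is\<in>permutations_of_set (e - {v}). (\<Prod>w\<in>e - {v}. x w) / fact (k - 1))"
      proof (intro sum.cong refl)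
        fix js assume "js \<in> permutations_of_set (e - {v})"
        then have "set js = e - {v}" "distinct js" by (auto simp: permutations_of_set_def)
        then show "prod_list (map x js) / fact (k - 1) = (\<Prod>w\<in>e - {v}. x w) / fact (k - 1)"
          using prod.distinct_set_conv_list[of js x] by simp
      qed
      also have "\<dots> = (\<Prod>w\<in>e - {v}. x w)" using c by simp
      finally show ?thesis .
    qed
    have "(\<Sum>is\<in>T. of_real (adjacency_tensor k G (v # is)) * prod_list (map x is))
        = (\<Sum>is\<in>{is \<in> T. insert v (set is) \<in> edges G}. prod_list (map x is) / fact (k - 1))"
      using finT by (intro sum.mono_neutral_cong_right) (auto simp: adjacency_tensor_def)
    also have "\<dots> = (\<Sum>e\<in>S. \<Sum>is\<in>permutations_of_set (e - {v}). prod_list (map x is) / fact (k - 1))"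
      unfolding 1[symmetric]
      by (rule sum.UNION_disjoint[OF finS]) (auto simp: S_def dest: permutations_of_setD)
    also have "\<dots> = (\<Sum>e\<in>S. \<Prod>w\<in>e - {v}. x w)"
      by (intro sum.cong refl 2)
    finally show ?thesis .
  qed
  have "tensor_apply k ?V (alpha_tensor k \<alpha> G) x v
      = of_real \<alpha> * (\<Sum>is\<in>T. of_real (degree_tensor k G (v # is)) * prod_list (map x is))
      + of_real (1 - \<alpha>) * (\<Sum>is\<in>T. of_real (adjacency_tensor k G (v # is)) * prod_list (map x is))"
    unfolding tensor_apply_def T_def[symmetric] alpha_tensor_def sum_distrib_left
      sum.distrib[symmetric]
    by (intro sum.cong refl) (simp add: algebra_simps)
  also have "\<dots> = vertex_form \<alpha> k (edges G) x v"
    unfolding deg adj vertex_form_def S_def[symmetric]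
    by (simp add: sum.distrib sum_distrib_left vertex_degree_def S_def mult_ac)
  finally show ?thesis .
qed

text \<open>Double counting of incidences: the product over an edge appears once for each of its
  \<open>k\<close> vertices, which is the origin of the factor \<open>k\<close> in
  \<open>edge_energy\<close>.\<close>

lemma energy_eq_sum_vertex_form:
  fixes x :: "'b \<Rightarrow> real"
  assumes G: "uniform_hypergraph k G" and k: "k \<ge> 1"
  shows "energy \<alpha> k (edges G) x = (\<Sum>v\<in>verts G. x v * vertex_form \<alpha> k (edges G) x v)"
proof -
  let ?V = "verts G" and ?E = "edges G"
  have fin: "finite ?V" "finite ?E" using G finite_edges[OF G] by (auto simp: uniform_hypergraph_def)
  have "(\<Sum>v\<in>?V. x v * vertex_form \<alpha> k ?E x v)
     = (\<Sum>v\<in>?V. \<Sum>e | e \<in> ?E \<and> v \<in> e. \<alpha> * x v ^ k + (1 - \<alpha>) * (\<Prod>w\<in>e. x w))"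
  proof (intro sum.cong refl)
    fix v assume "v \<in> ?V"
    show "x v * vertex_form \<alpha> k ?E x v
        = (\<Sum>e | e \<in> ?E \<and> v \<in> e. \<alpha> * x v ^ k + (1 - \<alpha>) * (\<Prod>w\<in>e. x w))"
      unfolding vertex_form_def sum_distrib_left
    proof (intro sum.cong refl)
      fix e assume e: "e \<in> {e. e \<in> ?E \<and> v \<in> e}"
      then have "finite e" using G fin(1) finite_subset unfolding uniform_hypergraph_def by blast
      then have "(\<Prod>w\<in>e. x w) = x v * (\<Prod>w\<in>e - {v}. x w)" using e by (simp add: prod.remove)
      moreover have "x v ^ k = x v * x v ^ (k - 1)" using k by (cases k) auto
      ultimately show "x v * (of_real \<alpha> * x v ^ (k - 1) + of_real (1 - \<alpha>) * (\<Prod>w\<in>e - {v}. x w))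
          = \<alpha> * x v ^ k + (1 - \<alpha>) * (\<Prod>w\<in>e. x w)"
        by (simp add: algebra_simps)
    qed
  qed
  also have "\<dots> = (\<Sum>e\<in>?E. \<Sum>v | v \<in> ?V \<and> v \<in> e. \<alpha> * x v ^ k + (1 - \<alpha>) * (\<Prod>w\<in>e. x w))"
    using sum.swap_restrict[OF fin] .
  also have "\<dots> = (\<Sum>e\<in>?E. edge_energy \<alpha> k x e)"
  proof (intro sum.cong refl)
    fix e assume "e \<in> ?E"
    then have "{v. v \<in> ?V \<and> v \<in> e} = e" "card e = k"
      using G unfolding uniform_hypergraph_def by auto
    then show "(\<Sum>v | v \<in> ?V \<and> v \<in> e. \<alpha> * x v ^ k + (1 - \<alpha>) * (\<Prod>w\<in>e. x w)) = edge_energy \<alpha> k x e"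
      by (simp add: edge_energy_def sum.distrib sum_distrib_left)
  qed
  finally show ?thesis by (simp add: energy_def)
qed

text \<open>Multiply the modulus of the eigenvalue equation at \<open>v\<close> by the modulus of
  \<open>x v\<close> and sum over \<open>v\<close>. The triangle inequality then bounds
  \<open>cmod l\<close> times the norm by the energy of the vector of moduli.\<close>

lemma eigenvalue_bound:
  assumes G: "uniform_hypergraph k G" and k: "k \<ge> 2" and \<alpha>: "0 \<le> \<alpha>" "\<alpha> < 1"
    and bound: "\<And>y. \<forall>w. 0 \<le> y w \<Longrightarrow> energy \<alpha> k (edges G) y \<le> r * (\<Sum>w\<in>verts G. y w ^ k)"
    and l: "tensor_eigenvalue k (verts G) (alpha_tensor k \<alpha> G) l"
  shows "cmod l \<le> r"
proof -
  let ?V = "verts G" and ?E = "edges G"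
  obtain x where x: "\<exists>v\<in>?V. x v \<noteq> 0"
    and eq: "\<And>v. v \<in> ?V \<Longrightarrow> vertex_form \<alpha> k ?E x v = l * x v ^ (k - 1)"
    using l tensor_apply_alpha_tensor[OF G, of _ \<alpha>] k unfolding tensor_eigenvalue_def by auto
  define y where "y w = cmod (x w)" for w
  have "cmod l * (\<Sum>w\<in>?V. y w ^ k) = (\<Sum>v\<in>?V. y v * cmod (vertex_form \<alpha> k ?E x v))"
  proof -
    have "y v * cmod (vertex_form \<alpha> k ?E x v) = cmod l * y v ^ k" if "v \<in> ?V" for v
    proof -
      have "cmod (vertex_form \<alpha> k ?E x v) = cmod l * y v ^ (k - 1)"
        unfolding eq[OF that] by (simp add: y_def norm_mult norm_power)
      then show ?thesis using k by (cases k) auto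
    qed
    then show ?thesis by (simp add: sum_distrib_left)
  qed
  also have "\<dots> \<le> (\<Sum>v\<in>?V. y v * vertex_form \<alpha> k ?E y v)"
  proof (intro sum_mono mult_left_mono)
    fix v
    have "cmod (vertex_form \<alpha> k ?E x v)
        \<le> (\<Sum>e | e \<in> ?E \<and> v \<in> e. cmod (of_real \<alpha> * x v ^ (k - 1) + of_real (1 - \<alpha>) * (\<Prod>w\<in>e - {v}. x w)))"
      unfolding vertex_form_def by (rule norm_sum)
    also have "\<dots> \<le> vertex_form \<alpha> k ?E y v"
      unfolding vertex_form_def
    proof (rule sum_mono)
      fix e
      have "cmod (of_real \<alpha> * x v ^ (k - 1)) = \<alpha> * y v ^ (k - 1)"
        using \<alpha> by (simp add: norm_mult norm_power y_def)
      moreover have "cmod (of_real (1 - \<alpha>) * (\<Prod>w\<in>e - {v}. x w)) = (1 - \<alpha>) * (\<Prod>w\<in>e - {v}. y w)"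
        using \<alpha> unfolding norm_mult norm_of_real by (simp add: prod_norm y_def)
      ultimately show "cmod (of_real \<alpha> * x v ^ (k - 1) + of_real (1 - \<alpha>) * (\<Prod>w\<in>e - {v}. x w))
          \<le> of_real \<alpha> * y v ^ (k - 1) + of_real (1 - \<alpha>) * (\<Prod>w\<in>e - {v}. y w)"
        using norm_triangle_ineq[of "of_real \<alpha> * x v ^ (k - 1)" "of_real (1 - \<alpha>) * (\<Prod>w\<in>e - {v}. x w)"]
        by simp
    qed
    finally show "cmod (vertex_form \<alpha> k ?E x v) \<le> vertex_form \<alpha> k ?E y v" .
  qed (simp add: y_def)
  also have "\<dots> = energy \<alpha> k ?E y"
    using energy_eq_sum_vertex_form[OF G, of \<alpha> y] k by simp
  also have "\<dots> \<le> r * (\<Sum>w\<in>?V. y w ^ k)"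
    by (rule bound) (simp add: y_def)
  finally have "cmod l * (\<Sum>w\<in>?V. y w ^ k) \<le> r * (\<Sum>w\<in>?V. y w ^ k)" .
  moreover have "(\<Sum>w\<in>?V. y w ^ k) > 0"
  proof -
    obtain v where "v \<in> ?V" "x v \<noteq> 0" using x by auto
    then show ?thesis
      using G by (intro sum_pos2[of _ v]) (auto simp: uniform_hypergraph_def y_def)
  qed
  ultimately show ?thesis by simp
qed

section \<open>Perron vectors\<close>

lemma energy_cong:
  assumes "uniform_hypergraph k G" "\<And>w. w \<in> verts G \<Longrightarrow> x w = y w"
  shows "energy \<alpha> k (edges G) x = energy \<alpha> k (edges G) y"
  unfolding energy_def
proof (rule sum.cong)
  fix e assume "e \<in> edges G"
  then have "\<And>w. w \<in> e \<Longrightarrow> x w = y w"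
    using assms unfolding uniform_hypergraph_def by blast
  then show "edge_energy \<alpha> k x e = edge_energy \<alpha> k y e"
    by (simp add: edge_energy_def cong: sum.cong prod.cong)
qed simp

lemma energy_scale:
  assumes "uniform_hypergraph k G"
  shows "energy \<alpha> k (edges G) (\<lambda>w. c * x w) = c ^ k * energy \<alpha> k (edges G) x"
  unfolding energy_def sum_distrib_left
proof (rule sum.cong)
  fix e assume "e \<in> edges G"
  then have "card e = k" using assms unfolding uniform_hypergraph_def by blast
  then show "edge_energy \<alpha> k (\<lambda>w. c * x w) e = c ^ k * edge_energy \<alpha> k x e"
    by (simp add: edge_energy_def power_mult_distrib prod.distrib flip: sum_distrib_left)
      (simp add: algebra_simps)
qed simp

text \<open>Compactness of the nonnegative unit sphere gives a maximizer there; homogeneity of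
  degree \<open>k\<close> extends the bound to all nonnegative vectors.\<close>

lemma energy_maximizer:
  assumes G: "uniform_hypergraph k G" and k: "k \<ge> 1" and ne: "verts G \<noteq> {}"
  obtains x r where "\<And>w. 0 \<le> x w" "(\<Sum>w\<in>verts G. x w ^ k) = 1" "energy \<alpha> k (edges G) x = r"
    "\<And>y. \<forall>w\<in>verts G. 0 \<le> y w \<Longrightarrow> energy \<alpha> k (edges G) y \<le> r * (\<Sum>w\<in>verts G. y w ^ k)"
proof -
  let ?V = "verts G" and ?E = "edges G"
  have finV: "finite ?V" using G by (simp add: uniform_hypergraph_def)
  \<comment> \<open>Vectors are functions on the whole, possibly infinite, vertex type. Pinning the
    irrelevant coordinates to 0 makes the set a product of compact sets.\<close>
  define K :: "('a \<Rightarrow> real) set" where "K = (\<Pi>\<^sub>E w\<in>UNIV. if w \<in> ?V then {0..1} else {0})"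
  define S where "S = K \<inter> {x. (\<Sum>w\<in>?V. x w ^ k) = 1}"
  have "compactin (product_topology (\<lambda>_. euclidean) UNIV) K"
    unfolding K_def compactin_PiE by (auto simp: compactin_euclidean_iff)
  then have "compact K" by (simp add: euclidean_product_topology compactin_euclidean_iff)
  have cont_coord: "continuous_on UNIV (\<lambda>x :: 'a \<Rightarrow> real. x w)" for w
    by (rule continuous_on_product_coordinates)
  have "closed {x :: 'a \<Rightarrow> real. (\<Sum>w\<in>?V. x w ^ k) = 1}"
    by (intro closed_Collect_eq continuous_intros cont_coord)
  then have "compact S" unfolding S_def using \<open>compact K\<close> by (rule compact_Int_closed[rotated])
  moreover have "S \<noteq> {}"
  proof -
    obtain v where "v \<in> ?V" using ne by auto
    then have "(\<lambda>w. if w = v then 1 else 0) \<in> S"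
      using finV k by (auto simp: S_def K_def if_distrib[of "\<lambda>t. t ^ k"] power_0_left cong: if_cong)
    then show ?thesis by auto
  qed
  moreover have "continuous_on S (energy \<alpha> k ?E)"
    unfolding energy_def[abs_def] edge_energy_def
    by (intro continuous_intros continuous_on_subset[OF cont_coord]) auto
  ultimately obtain x where x: "x \<in> S" and max: "\<And>y. y \<in> S \<Longrightarrow> energy \<alpha> k ?E y \<le> energy \<alpha> k ?E x"
    using continuous_attains_sup[of S "energy \<alpha> k ?E"] by blast
  show thesis
  proof
    have "x w \<in> (if w \<in> ?V then {0..1} else {0})" for w
      using x unfolding S_def K_def by (auto simp del: if_split_mem2 split del: if_split)
    then show "0 \<le> x w" for w by (metis atLeastAtMost_iff order_refl singletonD)
    show "(\<Sum>w\<in>?V. x w ^ k) = 1" using x by (simp add: S_def)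
    fix y :: "'a \<Rightarrow> real" assume y: "\<forall>w\<in>?V. 0 \<le> y w"
    define s where "s = (\<Sum>w\<in>?V. y w ^ k)"
    have s0: "0 \<le> s" unfolding s_def using y by (intro sum_nonneg) auto
    show "energy \<alpha> k ?E y \<le> energy \<alpha> k ?E x * (\<Sum>w\<in>?V. y w ^ k)"
    \<comment> \<open>A vector of norm zero cannot be normalised, but it vanishes on
      \<open>?V\<close> and so has energy zero.\<close>
    proof (cases "s = 0")
      case True
      then have y0: "y w = 0" if "w \<in> ?V" for w
        using that y finV unfolding s_def by (subst (asm) sum_nonneg_eq_0_iff) auto
      have "energy \<alpha> k ?E y = energy \<alpha> k ?E (\<lambda>w. 0 * y w)"
        using y0 by (intro energy_cong[OF G]) auto
      also have "\<dots> = 0" unfolding energy_scale[OF G] using k by simp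
      finally show ?thesis using True by (simp add: s_def)
    next
      case False
      then have s: "s > 0" using s0 by simp
      define c where "c = root k s"
      have c: "c > 0" "c ^ k = s" using s k by (auto simp: c_def)
      define z where "z w = (if w \<in> ?V then inverse c * y w else 0)" for w
      have zs: "(\<Sum>w\<in>?V. z w ^ k) = 1"
        using s c by (simp add: z_def power_mult_distrib power_inverse flip: sum_distrib_left s_def)
      have z0: "0 \<le> z w" for w using y c by (auto simp: z_def)
      have "z w \<le> 1" if "w \<in> ?V" for w
      proof -
        have "z w ^ k \<le> (\<Sum>w\<in>?V. z w ^ k)"
          using that finV z0 by (intro member_le_sum) auto
        then show ?thesis using zs k z0 by (metis power_le_one_iff less_one linorder_not_less)
      qed
      then have "z \<in> K" using z0 by (auto simp: K_def) (simp add: z_def)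
      then have "z \<in> S" using zs by (simp add: S_def)
      then have "energy \<alpha> k ?E z \<le> energy \<alpha> k ?E x" by (rule max)
      moreover have "energy \<alpha> k ?E z = energy \<alpha> k ?E (\<lambda>w. inverse c * y w)"
        by (intro energy_cong[OF G]) (auto simp: z_def)
      moreover have "\<dots> = energy \<alpha> k ?E y / s"
        unfolding energy_scale[OF G] using c by (simp add: power_inverse divide_inverse)
      ultimately have "energy \<alpha> k ?E y / s \<le> energy \<alpha> k ?E x" by simp
      then show ?thesis using s by (simp only: pos_divide_le_eq flip: s_def)
    qed
  qed simp
qed

text \<open>When only the entry at \<open>v\<close> varies, the energy minus \<open>r\<close> times
  the norm has the form \<open>A + B * t ^ k + C * t\<close>. It has a maximum at
  \<open>t = x v\<close>, and the vanishing of its derivative there, divided by \<open>k\<close>, is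
  the eigenvalue equation at \<open>v\<close>.\<close>

lemma maximizer_vertex_form:
  fixes x :: "'a \<Rightarrow> real"
  assumes G: "uniform_hypergraph k G" and k: "k \<ge> 1"
    and pos: "\<And>w. w \<in> verts G \<Longrightarrow> 0 < x w" and v: "v \<in> verts G"
    and eq: "energy \<alpha> k (edges G) x = r * (\<Sum>w\<in>verts G. x w ^ k)"
    and bound: "\<And>y. \<forall>w\<in>verts G. 0 \<le> y w \<Longrightarrow> energy \<alpha> k (edges G) y \<le> r * (\<Sum>w\<in>verts G. y w ^ k)"
  shows "vertex_form \<alpha> k (edges G) x v = r * x v ^ (k - 1)"
proof -
  let ?V = "verts G" and ?E = "edges G"
  have finV: "finite ?V" and finE: "finite ?E" using G finite_edges[OF G] by (auto simp: uniform_hypergraph_def)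
  define S where "S = {e \<in> ?E. v \<in> e}"
  define P where "P = (\<Sum>e\<in>S. \<Prod>w\<in>e - {v}. x w)"
  define B where "B = \<alpha> * real (card S) - r"
  define C where "C = (1 - \<alpha>) * (real k * P)"
  define A where "A = sum (edge_energy \<alpha> k x) (?E - S) + \<alpha> * (\<Sum>e\<in>S. \<Sum>w\<in>e - {v}. x w ^ k)
     - r * (\<Sum>w\<in>?V - {v}. x w ^ k)"
  define g where "g t = energy \<alpha> k ?E (x(v := t)) - r * (\<Sum>w\<in>?V. (x(v := t)) w ^ k)" for t
  have g: "g t = A + B * t ^ k + C * t" for t
  proof -
    have 1: "edge_energy \<alpha> k (x(v := t)) e = edge_energy \<alpha> k x e" if "e \<in> ?E - S" for e
    proof -
      have "(x(v := t)) w = x w" if "w \<in> e" for w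
        using that \<open>e \<in> ?E - S\<close> by (auto simp: S_def)
      then show ?thesis by (simp add: edge_energy_def cong: sum.cong prod.cong)
    qed
    have 2: "edge_energy \<alpha> k (x(v := t)) e
        = \<alpha> * t ^ k + \<alpha> * (\<Sum>w\<in>e - {v}. x w ^ k) + (1 - \<alpha>) * real k * t * (\<Prod>w\<in>e - {v}. x w)"
      if "e \<in> S" for e
    proof -
      have e: "finite e" "v \<in> e"
        using that G finV finite_subset[of e ?V] unfolding uniform_hypergraph_def S_def by auto
      have "(\<Sum>w\<in>e. (x(v := t)) w ^ k) = t ^ k + (\<Sum>w\<in>e - {v}. x w ^ k)"
        unfolding sum.remove[OF e] by (auto intro!: sum.cong)
      moreover have "(\<Prod>w\<in>e. (x(v := t)) w) = t * (\<Prod>w\<in>e - {v}. x w)"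
        unfolding prod.remove[OF e] by (auto intro!: prod.cong)
      ultimately show ?thesis by (simp add: edge_energy_def algebra_simps)
    qed
    have "energy \<alpha> k ?E (x(v := t))
        = sum (edge_energy \<alpha> k (x(v := t))) (?E - S) + sum (edge_energy \<alpha> k (x(v := t))) S"
      unfolding energy_def using finE by (intro sum.subset_diff) (auto simp: S_def)
    also have "\<dots> = sum (edge_energy \<alpha> k x) (?E - S) + (\<Sum>e\<in>S.
        \<alpha> * t ^ k + \<alpha> * (\<Sum>w\<in>e - {v}. x w ^ k) + (1 - \<alpha>) * real k * t * (\<Prod>w\<in>e - {v}. x w))"
      using 1 2 by (intro arg_cong2[of _ _ _ _ "(+)"] sum.cong refl) auto
    also have "\<dots> = sum (edge_energy \<alpha> k x) (?E - S) + (real (card S) * (\<alpha> * t ^ k)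
        + \<alpha> * (\<Sum>e\<in>S. \<Sum>w\<in>e - {v}. x w ^ k) + (1 - \<alpha>) * real k * t * P)"
      by (simp add: sum.distrib P_def flip: sum_distrib_left)
    finally have "energy \<alpha> k ?E (x(v := t)) = \<dots>" .
    moreover have "(\<Sum>w\<in>?V. (x(v := t)) w ^ k) = t ^ k + (\<Sum>w\<in>?V - {v}. x w ^ k)"
      unfolding sum.remove[OF finV v] by (auto intro!: sum.cong)
    ultimately show ?thesis unfolding g_def A_def B_def C_def by (simp add: algebra_simps)
  qed
  have "(g has_real_derivative B * (real k * x v ^ (k - 1)) + C) (at (x v))"
    unfolding g by (auto intro!: derivative_eq_intros)
  \<comment> \<open>Within distance \<open>x v\<close> the varied entry remains positive, so the
    bound applies to the varied vector.\<close>
  moreover have "g t \<le> g (x v)" if "\<bar>x v - t\<bar> < x v" for t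
  proof -
    have "t > 0" using that by linarith
    then have "energy \<alpha> k ?E (x(v := t)) \<le> r * (\<Sum>w\<in>?V. (x(v := t)) w ^ k)"
      using pos by (intro bound) (auto simp: less_imp_le)
    then show ?thesis using eq unfolding g_def by simp
  qed
  ultimately have "B * (real k * x v ^ (k - 1)) + C = 0"
    using pos[OF v] by (intro DERIV_local_max[of g _ "x v" "x v"]) auto
  then have "real k * (B * x v ^ (k - 1) + (1 - \<alpha>) * P) = 0"
    by (simp add: C_def algebra_simps)
  then have "B * x v ^ (k - 1) + (1 - \<alpha>) * P = 0" using k by simp
  moreover have "vertex_form \<alpha> k ?E x v = real (card S) * (\<alpha> * x v ^ (k - 1)) + (1 - \<alpha>) * P"
    unfolding vertex_form_def P_def S_def by (simp add: sum.distrib sum_distrib_left)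
  ultimately show ?thesis by (simp add: B_def algebra_simps)
qed

text \<open>Otherwise \<open>P\<close> would spread from \<open>a\<close> along every edge of a walk
  and reach \<open>b\<close>. It is applied to the support of a vector.\<close>

lemma connected_crossing_edge:
  assumes con: "connected_hypergraph G" and "a \<in> verts G" "b \<in> verts G" "P a" "\<not> P b"
  obtains e c d where "e \<in> edges G" "c \<in> e" "d \<in> e" "P c" "\<not> P d"
proof (rule ccontr)
  assume "\<not> thesis"
  then have no: "\<And>e c d. e \<in> edges G \<Longrightarrow> c \<in> e \<Longrightarrow> d \<in> e \<Longrightarrow> P c \<Longrightarrow> P d"
    using that by blast
  have "(a, b) \<in> {(a, b). \<exists>e\<in>edges G. a \<in> e \<and> b \<in> e}\<^sup>*"
    using assms unfolding connected_hypergraph_def by blast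
  then have "P b"
    using \<open>P a\<close> by (induction rule: rtrancl_induct) (use no in blast)+
  then show False using \<open>\<not> P b\<close> by simp
qed

lemma edge_energy_mono:
  assumes "0 \<le> \<alpha>" "\<alpha> \<le> 1" "\<And>w. w \<in> e \<Longrightarrow> 0 \<le> x w" "\<And>w. w \<in> e \<Longrightarrow> x w \<le> y w"
  shows "edge_energy \<alpha> k x e \<le> edge_energy \<alpha> k y e"
  unfolding edge_energy_def using assms
  by (intro add_mono mult_left_mono sum_mono power_mono prod_mono) auto

text \<open>
  Raising the zero entries on an edge that meets both zero and nonzero entries to \<open>\<epsilon>\<close> increases
  the norm by a multiple of \<open>\<epsilon> ^ k\<close>, but the energy by a multiple of a smaller power of \<open>\<epsilon>\<close>.
\<close>
lemma maximizer_pos: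
  assumes G: "uniform_hypergraph k G" and con: "connected_hypergraph G"
    and \<alpha>: "0 \<le> \<alpha>" "\<alpha> < 1"
    and nn: "\<And>w. 0 \<le> x w" and one: "(\<Sum>w\<in>verts G. x w ^ k) = 1" and k: "k \<ge> 1"
    and eq: "energy \<alpha> k (edges G) x = r"
    and bound: "\<And>y. \<forall>w\<in>verts G. 0 \<le> y w \<Longrightarrow> energy \<alpha> k (edges G) y \<le> r * (\<Sum>w\<in>verts G. y w ^ k)"
    and b: "b \<in> verts G"
  shows "0 < x b"
proof (rule ccontr)
  let ?V = "verts G" and ?E = "edges G"
  assume "\<not> 0 < x b"
  then have xb: "x b = 0" using nn[of b] by simp
  have finV: "finite ?V" and finE: "finite ?E" using G finite_edges[OF G] by (auto simp: uniform_hypergraph_def)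
  have "\<exists>a\<in>?V. x a \<noteq> 0"
  proof (rule ccontr)
    assume "\<not> ?thesis"
    then have "(\<Sum>w\<in>?V. x w ^ k) = 0" using k by (auto simp: power_0_left)
    then show False using one by simp
  qed
  then obtain a where a: "a \<in> ?V" "x a \<noteq> 0" by auto
  obtain e c d where e: "e \<in> ?E" "c \<in> e" "d \<in> e" "x c \<noteq> 0" "x d = 0"
    using connected_crossing_edge[OF con a(1) b, of "\<lambda>w. x w \<noteq> 0"] a(2) xb by auto
  have eV: "e \<subseteq> ?V" "card e = k" using G e(1) by (auto simp: uniform_hypergraph_def)
  then have fe: "finite e" using finV finite_subset by blast
  define Z where "Z = {w \<in> e. x w = 0}"
  have Z: "Z \<subseteq> e" "finite Z" "d \<in> Z" "c \<notin> Z" using e fe by (auto simp: Z_def)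
  define m where "m = card Z"
  have "m < k" unfolding m_def using psubset_card_mono[of e Z] Z e fe eV by blast
  have "m > 0" unfolding m_def using Z by (auto simp: card_gt_0_iff)
  define K where "K = (1 - \<alpha>) * (real k * (\<Prod>w\<in>e - Z. x w))"
  have "(\<Prod>w\<in>e - Z. x w) > 0"
    by (rule prod_pos) (use nn in \<open>auto simp: Z_def less_le\<close>)
  then have "K > 0" using \<alpha> k by (simp add: K_def)
  have key: "K \<le> \<bar>r\<bar> * real m * \<epsilon>" if \<epsilon>: "0 < \<epsilon>" "\<epsilon> \<le> 1" for \<epsilon>
  proof -
    define y where "y w = (if w \<in> Z then \<epsilon> else x w)" for w
    have xy: "x w \<le> y w" for w using \<epsilon> by (auto simp: y_def Z_def)
    have y0: "0 \<le> y w" for w using nn \<epsilon> by (auto simp: y_def)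
    have prod_split: "(\<Prod>w\<in>e. y w) = \<epsilon> ^ m * (\<Prod>w\<in>e - Z. x w)"
    proof -
      have "(\<Prod>w\<in>e. y w) = (\<Prod>w\<in>e - Z. y w) * (\<Prod>w\<in>Z. y w)"
        using Z fe by (intro prod.subset_diff) auto
      then show ?thesis by (simp add: y_def m_def)
    qed
    have "edge_energy \<alpha> k x e + K * \<epsilon> ^ m \<le> edge_energy \<alpha> k y e"
    proof -
      have "(\<Prod>w\<in>e. x w) = 0" using e fe by auto
      moreover have "\<alpha> * (\<Sum>w\<in>e. x w ^ k) \<le> \<alpha> * (\<Sum>w\<in>e. y w ^ k)"
        using \<alpha> nn xy by (intro mult_left_mono sum_mono power_mono) auto
      ultimately show ?thesis unfolding edge_energy_def prod_split K_def by (simp add: mult_ac)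
    qed
    moreover have "(\<Sum>f\<in>?E - {e}. edge_energy \<alpha> k x f) \<le> (\<Sum>f\<in>?E - {e}. edge_energy \<alpha> k y f)"
      using \<alpha> nn xy by (intro sum_mono edge_energy_mono) auto
    ultimately have "r + K * \<epsilon> ^ m \<le> energy \<alpha> k ?E y"
      unfolding eq[symmetric] energy_def sum.remove[OF finE e(1)] by simp
    also have "\<dots> \<le> r * (\<Sum>w\<in>?V. y w ^ k)" using y0 by (intro bound) auto
    also have "(\<Sum>w\<in>?V. y w ^ k) = 1 + real m * \<epsilon> ^ k"
    proof -
      have ZV: "Z \<subseteq> ?V" using Z eV by auto
      have "(\<Sum>w\<in>?V. y w ^ k) = (\<Sum>w\<in>?V - Z. y w ^ k) + (\<Sum>w\<in>Z. y w ^ k)"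
        using sum.subset_diff[OF ZV finV] .
      also have "(\<Sum>w\<in>Z. y w ^ k) = real m * \<epsilon> ^ k" by (simp add: y_def m_def)
      also have "(\<Sum>w\<in>?V - Z. y w ^ k) = (\<Sum>w\<in>?V - Z. x w ^ k)" by (simp add: y_def)
      also have "\<dots> = (\<Sum>w\<in>?V. x w ^ k)"
        using sum.subset_diff[OF ZV finV, of "\<lambda>w. x w ^ k"] k
        by (simp add: Z_def power_0_left)
      finally show ?thesis using one by simp
    qed
    finally have "K * \<epsilon> ^ m \<le> r * real m * \<epsilon> ^ k" by (simp add: algebra_simps)
    also have "\<dots> \<le> \<bar>r\<bar> * real m * \<epsilon> ^ k" using \<epsilon> by (intro mult_right_mono) auto
    also have "\<dots> \<le> \<bar>r\<bar> * real m * (\<epsilon> * \<epsilon> ^ m)"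
    proof (rule mult_left_mono)
      show "\<epsilon> ^ k \<le> \<epsilon> * \<epsilon> ^ m"
        using \<epsilon> \<open>m < k\<close> power_decreasing[of "Suc m" k \<epsilon>] by simp
    qed auto
    finally show ?thesis using \<epsilon> by simp
  qed
  define D where "D = \<bar>r\<bar> * real m"
  have D: "D \<ge> 0" by (simp add: D_def)
  \<comment> \<open>Chosen to give \<open>D * \<epsilon> \<le> K / 2\<close>, which contradicts
    \<open>key\<close>. The summand 1 avoids division by zero when \<open>D = 0\<close>, and the
    minimum keeps \<open>\<epsilon>\<close> in the range of \<open>key\<close>.\<close>
  define \<epsilon> where "\<epsilon> = min 1 (K / (2 * (D + 1)))"
  have "\<epsilon> > 0" using \<open>K > 0\<close> D by (simp add: \<epsilon>_def)
  then have "K \<le> D * \<epsilon>" unfolding D_def by (rule key) (simp add: \<epsilon>_def)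
  also have "\<dots> \<le> (D + 1) * (K / (2 * (D + 1)))"
    using D \<open>\<epsilon> > 0\<close> by (intro mult_mono) (auto simp: \<epsilon>_def)
  also have "\<dots> = K / 2" using D by (simp add: divide_simps)
  finally show False using \<open>K > 0\<close> by simp
qed

text \<open>The maximum \<open>r\<close> of the energy is itself an eigenvalue, with the positive
  maximizer as eigenvector, and by \<open>eigenvalue_bound\<close> no modulus exceeds it. Since
  \<open>r \<ge> 0\<close>, it is its own modulus, so the supremum is attained there.\<close>

lemma alpha_spectral_radius_energy:
  assumes G: "uniform_hypergraph k G" and con: "connected_hypergraph G"
    and k: "k \<ge> 2" and ne: "verts G \<noteq> {}" and \<alpha>: "0 \<le> \<alpha>" "\<alpha> < 1"
  shows alpha_spectral_radius_bound:
      "\<And>y. \<forall>w\<in>verts G. 0 \<le> y w \<Longrightarrow>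
        energy \<alpha> k (edges G) y \<le> alpha_spectral_radius k \<alpha> G * (\<Sum>w\<in>verts G. y w ^ k)"
    and alpha_spectral_radius_attained:
      "\<exists>x. (\<forall>w\<in>verts G. 0 < x w) \<and>
        energy \<alpha> k (edges G) x = alpha_spectral_radius k \<alpha> G * (\<Sum>w\<in>verts G. x w ^ k)"
proof -
  let ?V = "verts G" and ?E = "edges G"
  have k1: "k \<ge> 1" using k by simp
  obtain x r where x: "\<And>w. 0 \<le> x w" "(\<Sum>w\<in>?V. x w ^ k) = 1" "energy \<alpha> k ?E x = r"
    and bound: "\<And>y. \<forall>w\<in>?V. 0 \<le> y w \<Longrightarrow> energy \<alpha> k ?E y \<le> r * (\<Sum>w\<in>?V. y w ^ k)"
    using energy_maximizer[OF G k1 ne, of \<alpha>] by metis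
  have pos: "0 < x w" if "w \<in> ?V" for w
    using maximizer_pos[OF G con \<alpha> x(1,2) k1 x(3) bound that] by simp
  have eq: "energy \<alpha> k ?E x = r * (\<Sum>w\<in>?V. x w ^ k)" using x by simp
  have eig: "vertex_form \<alpha> k ?E x v = r * x v ^ (k - 1)" if "v \<in> ?V" for v
    using maximizer_vertex_form[OF G k1 pos that eq bound] by simp
  have "r \<ge> 0"
    using \<alpha> x(1) unfolding x(3)[symmetric] energy_def edge_energy_def
    by (intro sum_nonneg add_nonneg_nonneg mult_nonneg_nonneg prod_nonneg) auto
  have "tensor_eigenvalue k ?V (alpha_tensor k \<alpha> G) (of_real r)"
    unfolding tensor_eigenvalue_def
  proof (intro exI[of _ "\<lambda>w. complex_of_real (x w)"] conjI ballI)
    show "\<exists>v\<in>?V. complex_of_real (x v) \<noteq> 0" using pos ne by fastforce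
    fix v assume v: "v \<in> ?V"
    have "vertex_form \<alpha> k ?E (\<lambda>w. complex_of_real (x w)) v = of_real (vertex_form \<alpha> k ?E x v)"
      unfolding vertex_form_def by simp
    then show "tensor_apply k ?V (alpha_tensor k \<alpha> G) (\<lambda>w. complex_of_real (x w)) v
        = of_real r * complex_of_real (x v) ^ (k - 1)"
      using tensor_apply_alpha_tensor[OF G k1 v] eig[OF v] by simp
  qed
  then have "alpha_spectral_radius k \<alpha> G = r"
    unfolding alpha_spectral_radius_def
  proof (intro cSup_eq_maximum)
    assume "tensor_eigenvalue k ?V (alpha_tensor k \<alpha> G) (of_real r)"
    then show "r \<in> {cmod l |l. tensor_eigenvalue k ?V (alpha_tensor k \<alpha> G) l}"
      using \<open>r \<ge> 0\<close> by (force intro!: exI[of _ "complex_of_real r"])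
    fix t assume "t \<in> {cmod l |l. tensor_eigenvalue k ?V (alpha_tensor k \<alpha> G) l}"
    then show "t \<le> r" using eigenvalue_bound[OF G k \<alpha>, of r] bound by auto
  qed
  then show "\<And>y. \<forall>w\<in>verts G. 0 \<le> y w \<Longrightarrow>
        energy \<alpha> k (edges G) y \<le> alpha_spectral_radius k \<alpha> G * (\<Sum>w\<in>verts G. y w ^ k)"
    and "\<exists>x. (\<forall>w\<in>verts G. 0 < x w) \<and>
        energy \<alpha> k (edges G) x = alpha_spectral_radius k \<alpha> G * (\<Sum>w\<in>verts G. x w ^ k)"
    using bound pos eq by blast+
qed

section \<open>Polarization\<close>

text \<open>Supermodularity of the product. The inductive step is a rearrangement inequality: the
  larger of the two new factors belongs with the larger product.\<close>

lemma prod_max_min: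
  fixes a b :: "'b \<Rightarrow> real"
  assumes "finite A" "\<And>w. w \<in> A \<Longrightarrow> 0 \<le> a w" "\<And>w. w \<in> A \<Longrightarrow> 0 \<le> b w"
  shows "prod a A + prod b A \<le> (\<Prod>w\<in>A. max (a w) (b w)) + (\<Prod>w\<in>A. min (a w) (b w))"
  using assms
proof (induction A rule: finite_induct)
  case (insert v A)
  let ?M = "\<Prod>w\<in>A. max (a w) (b w)" and ?m = "\<Prod>w\<in>A. min (a w) (b w)"
  have IH: "prod a A + prod b A \<le> ?M + ?m" using insert by auto
  have le: "prod a A \<le> ?M" "prod b A \<le> ?M" "?m \<le> prod a A" "?m \<le> prod b A"
    using insert.prems by (auto intro!: prod_mono)
  have *: "s * p + t * q \<le> s * P + t * Q"
    if "t \<le> s" "0 \<le> t" "p \<le> P" "p + q \<le> P + Q" for s t p q P Q :: real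
  proof -
    have "0 \<le> (s - t) * (P - p) + t * (P + Q - (p + q))" using that by simp
    then show ?thesis by (simp add: algebra_simps)
  qed
  show ?case
  proof (cases "b v \<le> a v")
    case True
    then show ?thesis
      using *[of "b v" "a v" "prod a A" ?M "prod b A" ?m] IH le insert
      by (simp add: max_absorb1 min_absorb2)
  next
    case False
    then show ?thesis
      using *[of "a v" "b v" "prod b A" ?M "prod a A" ?m] IH le insert
      by (simp add: max_absorb2 min_absorb1 add.commute)
  qed
qed simp

text \<open>
  \<open>\<sigma>\<close> is a reflection, \<open>P\<close> the open half onto which the larger values are moved.
\<close>
locale polarization =
  fixes \<sigma> :: "'b \<Rightarrow> 'b" and P :: "'b set"
  assumes inv: "\<sigma> (\<sigma> w) = w"
    and half: "w \<in> P \<Longrightarrow> \<sigma> w \<notin> P"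
    and moved: "\<sigma> w \<noteq> w \<Longrightarrow> w \<in> P \<or> \<sigma> w \<in> P"
begin

text \<open>Fixed points are included because \<open>polarize\<close> leaves their entries alone;
  they do no harm in an edge that otherwise lies in \<open>P\<close>.\<close>

definition closed_half :: "'b set" where
  "closed_half = P \<union> {w. \<sigma> w = w}"

definition polarize :: "('b \<Rightarrow> real) \<Rightarrow> 'b \<Rightarrow> real" where
  "polarize x w = (if w \<in> P then max (x w) (x (\<sigma> w)) else min (x w) (x (\<sigma> w)))"

lemma polarize_half: "w \<in> closed_half \<Longrightarrow> polarize x w = max (x w) (x (\<sigma> w))"
  by (auto simp: closed_half_def polarize_def)

lemma polarize_image: "w \<in> closed_half \<Longrightarrow> polarize x (\<sigma> w) = min (x w) (x (\<sigma> w))"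
  using half by (auto simp: closed_half_def polarize_def inv)

lemma polarize_ge: "w \<in> closed_half \<Longrightarrow> x w \<le> polarize x w"
  by (simp add: polarize_half)

text \<open>On each mirrored pair, polarization is either the identity or the swap. Hence everything
  symmetric in the two entries is preserved.\<close>

lemma polarize_cases:
  obtains "polarize x w = x w" "polarize x (\<sigma> w) = x (\<sigma> w)"
  | "polarize x w = x (\<sigma> w)" "polarize x (\<sigma> w) = x w"
proof (cases "\<sigma> w = w")
  case True
  then show ?thesis using that by (simp add: polarize_def)
next
  case False
  then have "(w \<in> P) \<noteq> (\<sigma> w \<in> P)" using half moved by blast
  then show ?thesis
    using that unfolding polarize_def inv
    by (cases "x w \<le> x (\<sigma> w)") (auto simp: max_absorb1 max_absorb2 min_absorb1 min_absorb2)
qed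

lemma polarize_pos: "0 < x w \<Longrightarrow> 0 < x (\<sigma> w) \<Longrightarrow> 0 < polarize x w"
  by (auto simp: polarize_def max_def)

lemma inj_reflection: "inj_on \<sigma> A"
  by (metis inj_onI inv)

lemma image_image_reflection: "\<sigma> ` \<sigma> ` A = A"
  by (auto simp: image_image inv)

lemma sum_power_polarize:
  fixes x :: "'b \<Rightarrow> real"
  shows "(\<Sum>w\<in>A. polarize x w ^ k) + (\<Sum>w\<in>\<sigma> ` A. polarize x w ^ k)
    = (\<Sum>w\<in>A. x w ^ k) + (\<Sum>w\<in>\<sigma> ` A. x w ^ k)"
proof -
  have "polarize x w ^ k + polarize x (\<sigma> w) ^ k = x w ^ k + x (\<sigma> w) ^ k" for w
    by (rule polarize_cases[of x w]) auto
  then show ?thesis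
    by (simp add: sum.reindex[OF inj_reflection] flip: sum.distrib)
qed

lemma sum_power_polarize_invariant:
  assumes "\<sigma> ` A = A"
  shows "(\<Sum>w\<in>A. polarize x w ^ k) = (\<Sum>w\<in>A. x w ^ k)"
  using sum_power_polarize[of x k A] assms by simp

text \<open>Instead of splitting \<open>A\<close> into orbits, the product is squared: reindexing
  one copy by \<sigma> pairs each entry with its mirror image, and nonnegativity allows the root to
  be taken.\<close>

lemma prod_polarize_invariant:
  assumes "\<sigma> ` A = A" and nn: "\<And>w. w \<in> A \<Longrightarrow> 0 \<le> x w"
  shows "(\<Prod>w\<in>A. polarize x w) = (\<Prod>w\<in>A. x w)"
proof -
  have *: "(\<Prod>w\<in>A. f (\<sigma> w)) = prod f A" for f :: "'b \<Rightarrow> real"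
    using prod.reindex[OF inj_reflection, of f A] assms(1) by simp
  have "polarize x w * polarize x (\<sigma> w) = x w * x (\<sigma> w)" for w
    by (rule polarize_cases[of x w]) auto
  then have "(\<Prod>w\<in>A. polarize x w) * (\<Prod>w\<in>A. polarize x (\<sigma> w)) = (\<Prod>w\<in>A. x w) * (\<Prod>w\<in>A. x (\<sigma> w))"
    by (simp flip: prod.distrib)
  then have "(\<Prod>w\<in>A. polarize x w)\<^sup>2 = (\<Prod>w\<in>A. x w)\<^sup>2"
    unfolding * by (simp add: power2_eq_square)
  moreover have "0 \<le> polarize x w" if "w \<in> A" for w
    using nn[of w] nn[of "\<sigma> w"] that assms(1) by (auto simp: polarize_def)
  ultimately show ?thesis using nn by (simp add: power2_eq_iff_nonneg prod_nonneg)
qed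

lemma edge_energy_invariant:
  assumes "\<sigma> ` e = e" "\<And>w. w \<in> e \<Longrightarrow> 0 \<le> x w"
  shows "edge_energy \<alpha> k (polarize x) e = edge_energy \<alpha> k x e"
  unfolding edge_energy_def
  using sum_power_polarize_invariant[OF assms(1)] prod_polarize_invariant[OF assms] by simp

lemma edge_energy_half:
  assumes "e \<subseteq> closed_half" "\<And>w. w \<in> e \<Longrightarrow> 0 \<le> x w" and "0 \<le> \<alpha>" "\<alpha> \<le> 1"
  shows "edge_energy \<alpha> k x e \<le> edge_energy \<alpha> k (polarize x) e"
  using assms by (intro edge_energy_mono polarize_ge) auto

text \<open>Polarization gives \<open>e\<close> all the maxima and its mirror image all the minima,
  so \<open>prod_max_min\<close> handles the products, while the two power sums together do not
  change.\<close>

lemma edge_energy_pair: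
  assumes e: "e \<subseteq> closed_half" "finite e"
    and nn: "\<And>w. w \<in> e \<Longrightarrow> 0 \<le> x w" "\<And>w. w \<in> e \<Longrightarrow> 0 \<le> x (\<sigma> w)" and \<alpha>: "\<alpha> \<le> 1"
  shows "edge_energy \<alpha> k x e + edge_energy \<alpha> k x (\<sigma> ` e)
    \<le> edge_energy \<alpha> k (polarize x) e + edge_energy \<alpha> k (polarize x) (\<sigma> ` e)"
proof -
  have "(\<Prod>w\<in>e. x w) + (\<Prod>w\<in>\<sigma> ` e. x w) \<le> (\<Prod>w\<in>e. polarize x w) + (\<Prod>w\<in>\<sigma> ` e. polarize x w)"
  proof -
    have "(\<Prod>w\<in>e. polarize x w) = (\<Prod>w\<in>e. max (x w) (x (\<sigma> w)))"
      using e by (intro prod.cong refl polarize_half) auto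
    moreover have "(\<Prod>w\<in>\<sigma> ` e. polarize x w) = (\<Prod>w\<in>e. min (x w) (x (\<sigma> w)))"
      using e by (auto simp: prod.reindex[OF inj_reflection] intro!: prod.cong polarize_image)
    ultimately show ?thesis
      using prod_max_min[of e x "\<lambda>w. x (\<sigma> w)"] e nn by (simp add: prod.reindex[OF inj_reflection])
  qed
  then have "(1 - \<alpha>) * (real k * ((\<Prod>w\<in>e. x w) + (\<Prod>w\<in>\<sigma> ` e. x w)))
      \<le> (1 - \<alpha>) * (real k * ((\<Prod>w\<in>e. polarize x w) + (\<Prod>w\<in>\<sigma> ` e. polarize x w)))"
    using \<alpha> by (intro mult_left_mono) auto
  moreover have "\<alpha> * ((\<Sum>w\<in>e. polarize x w ^ k) + (\<Sum>w\<in>\<sigma> ` e. polarize x w ^ k))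
    = \<alpha> * ((\<Sum>w\<in>e. x w ^ k) + (\<Sum>w\<in>\<sigma> ` e. x w ^ k))"
    unfolding sum_power_polarize ..
  ultimately show ?thesis by (simp add: edge_energy_def algebra_simps)
qed

text \<open>The third alternative admits an edge across the centre. Such an edge must be its own
  mirror image, since otherwise maxima and minima would mix in one product and nothing could be
  concluded.\<close>

definition polarized_edge :: "'b set \<Rightarrow> bool" where
  "polarized_edge e \<longleftrightarrow> e \<subseteq> closed_half \<or> \<sigma> ` e \<subseteq> closed_half \<or> \<sigma> ` e = e"

text \<open>Every edge is summed together with its mirror image. As reflection permutes
  \<open>E\<close>, this counts the energy twice on both sides, and no representatives of the pairs
  have to be chosen.\<close>

lemma energy_polarize:
  assumes "finite E" "(`) \<sigma> ` E = E" "\<And>e. e \<in> E \<Longrightarrow> polarized_edge e"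
    and fin: "\<And>e. e \<in> E \<Longrightarrow> finite e"
    and nn: "\<And>w. 0 \<le> x w" and \<alpha>: "\<alpha> \<le> 1"
  shows "energy \<alpha> k E x \<le> energy \<alpha> k E (polarize x)"
proof -
  have inj: "inj_on ((`) \<sigma>) E" by (metis image_image_reflection inj_onI)
  have reindex: "(\<Sum>e\<in>E. edge_energy \<alpha> k y (\<sigma> ` e)) = energy \<alpha> k E y" for y
    using sum.reindex[OF inj, of "edge_energy \<alpha> k y"] assms(2) by (simp add: energy_def)
  have "edge_energy \<alpha> k x e + edge_energy \<alpha> k x (\<sigma> ` e)
    \<le> edge_energy \<alpha> k (polarize x) e + edge_energy \<alpha> k (polarize x) (\<sigma> ` e)" if e: "e \<in> E" for e
  proof -
    consider "e \<subseteq> closed_half" | "\<sigma> ` e \<subseteq> closed_half" | "\<sigma> ` e = e"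
      using assms(3)[OF e] by (auto simp: polarized_edge_def)
    then show ?thesis
    proof cases
      case 1
      then show ?thesis using edge_energy_pair fin[OF e] nn \<alpha> by auto
    next
      case 2
      then show ?thesis
        using edge_energy_pair[of "\<sigma> ` e" x \<alpha> k] fin[OF e] nn \<alpha>
        by (simp add: image_image_reflection add.commute)
    next
      case 3
      then show ?thesis using edge_energy_invariant[of e x \<alpha> k] nn by simp
    qed
  qed
  then have "(\<Sum>e\<in>E. edge_energy \<alpha> k x e + edge_energy \<alpha> k x (\<sigma> ` e))
    \<le> (\<Sum>e\<in>E. edge_energy \<alpha> k (polarize x) e + edge_energy \<alpha> k (polarize x) (\<sigma> ` e))"
    by (rule sum_mono)
  then show ?thesis by (simp add: sum.distrib reindex energy_def)
qed

end

section \<open>Reflection of a loose path\<close>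

text \<open>A loose path given by functions of the index instead of lists, so that reversal and
  gluing become index arithmetic. The edge \<open>f i\<close> joins \<open>pos i\<close> to
  \<open>pos (Suc i)\<close>. \<open>M = 0\<close> stands for a single vertex, which occurs for an
  empty branch or when \<open>u = v\<close>.\<close>

locale loose_line =
  fixes k M :: nat and pos :: "nat \<Rightarrow> 'b" and f :: "nat \<Rightarrow> 'b set"
  assumes k: "k \<ge> 2"
    and card_f: "i < M \<Longrightarrow> card (f i) = k"
    and pos_f: "i < M \<Longrightarrow> pos i \<in> f i" "i < M \<Longrightarrow> pos (Suc i) \<in> f i"
    and pos_neq: "i < M \<Longrightarrow> pos i \<noteq> pos (Suc i)"
    and f_adjacent: "Suc i < M \<Longrightarrow> f i \<inter> f (Suc i) \<subseteq> {pos (Suc i)}"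
    and f_disjoint: "i + 2 \<le> j \<Longrightarrow> j < M \<Longrightarrow> f i \<inter> f j = {}"
begin

lemma f_Int: "i < j \<Longrightarrow> j < M \<Longrightarrow> w \<in> f i \<Longrightarrow> w \<in> f j \<Longrightarrow> j = Suc i \<and> w = pos j"
  using f_adjacent[of i] f_disjoint[of i j] by (cases "j = Suc i") auto

lemma pos_in_f_iff:
  assumes "i \<le> M" "j < M"
  shows "pos i \<in> f j \<longleftrightarrow> i = j \<or> i = Suc j"
proof
  assume a: "pos i \<in> f j"
  show "i = j \<or> i = Suc j"
  proof (cases i j rule: linorder_cases)
    case less
    then have "j = Suc i \<and> pos i = pos j" using f_Int[of i j "pos i"] assms a pos_f by simp
    then show ?thesis using pos_neq[of i] less assms by auto
  next
    case greater
    then obtain i' where i': "i = Suc i'" by (cases i) auto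
    show ?thesis
    proof (cases "i' = j")
      case False
      have "pos i \<in> f i'" using assms i' pos_f by simp
      then have "i' = Suc j \<and> pos i = pos i'"
        using f_Int[OF _ _ a] False assms i' greater by simp
      then show ?thesis using pos_neq[of i', symmetric] i' assms by simp
    qed (use i' in simp)
  qed simp
qed (use assms pos_f in auto)

lemma pos_inj: "i \<le> M \<Longrightarrow> j \<le> M \<Longrightarrow> pos i = pos j \<Longrightarrow> i = j"
proof (induction i j rule: linorder_wlog)
  case (le i j)
  show ?case
  proof (rule ccontr)
    assume "i \<noteq> j"
    then obtain j' where j': "j = Suc j'" "i \<le> j'" using le by (cases j) auto
    then have "pos i \<in> f j'" using le pos_f by simp
    then have "i = j'" using pos_in_f_iff[of i j'] le j' by simp
    then show False using pos_neq[of i] le j' by simp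
  qed
qed auto

section \<open>Coordinates for the vertices of a loose line\<close>

definition inner :: "nat \<Rightarrow> 'b set" where
  "inner i = f i - {pos i, pos (Suc i)}"

lemma finite_f: "i < M \<Longrightarrow> finite (f i)"
  using card_f[of i] k card_ge_0_finite[of "f i"] by simp

lemma inner_enum: "i < M \<Longrightarrow> \<exists>g. bij_betw g {1..<k - 1} (inner i)"
proof -
  assume i: "i < M"
  have "card (inner i) = k - 2"
    unfolding inner_def using card_f[OF i] pos_f[OF i] pos_neq[OF i] finite_f[OF i]
    by (subst card_Diff_subset) auto
  moreover have "finite (inner i)" using finite_f[OF i] by (simp add: inner_def)
  ultimately show ?thesis
    using finite_same_card_bij[of "{1..<k - 1}" "inner i"] by auto
qed

text \<open>\<open>(i, 0)\<close> addresses the joint \<open>pos i\<close>, and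
  \<open>(i, j)\<close> with \<open>0 < j\<close> addresses one of the \<open>k - 2\<close> inner
  vertices of the edge \<open>f i\<close>, in an arbitrary enumeration.\<close>

definition index :: "(nat \<times> nat) set" where
  "index = {0..M} \<times> {0} \<union> {0..<M} \<times> {1..<k - 1}"

definition inner_label :: "nat \<Rightarrow> nat \<Rightarrow> 'b" where
  "inner_label i = (SOME g. bij_betw g {1..<k - 1} (inner i))"

definition label :: "nat \<times> nat \<Rightarrow> 'b" where
  "label = (\<lambda>(i, j). if j = 0 then pos i else inner_label i j)"

lemma inner_label: "i < M \<Longrightarrow> bij_betw (inner_label i) {1..<k - 1} (inner i)"
  unfolding inner_label_def using someI_ex[OF inner_enum] .

lemma inner_label_mem: "i < M \<Longrightarrow> 0 < j \<Longrightarrow> j < k - 1 \<Longrightarrow> inner_label i j \<in> inner i"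
  using bij_betwE[OF inner_label] by auto

lemma inner_disjoint:
  assumes "i < M" "j < M" "w \<in> inner i" "w \<in> inner j"
  shows "i = j"
  using f_Int[of i j w] f_Int[of j i w] assms
  by (cases i j rule: linorder_cases) (auto simp: inner_def)

lemma pos_notin_inner: "i \<le> M \<Longrightarrow> j < M \<Longrightarrow> pos i \<notin> inner j"
  using pos_in_f_iff[of i j] by (auto simp: inner_def)

lemma inj_label: "inj_on label index"
proof (rule inj_onI, clarify)
  fix i j i' j' assume a: "(i, j) \<in> index" "(i', j') \<in> index" "label (i, j) = label (i', j')"
  consider "j = 0" "j' = 0" | "j = 0" "j' > 0" | "j > 0" "j' = 0" | "j > 0" "j' > 0" by auto
  then show "i = i' \<and> j = j'"
  proof cases
    case 1
    then show ?thesis using a pos_inj by (auto simp: index_def label_def)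
  next
    case 2
    then show ?thesis
      using a pos_notin_inner[of i i'] inner_label_mem[of i' j'] by (auto simp: index_def label_def)
  next
    case 3
    then show ?thesis
      using a pos_notin_inner[of i' i] inner_label_mem[of i j] by (auto simp: index_def label_def)
  next
    case 4
    then have b: "i < M" "i' < M" "j \<in> {1..<k - 1}" "j' \<in> {1..<k - 1}"
        "inner_label i j = inner_label i' j'"
      using a by (auto simp: index_def label_def)
    then have "i = i'"
      using inner_label_mem[of i j] inner_label_mem[of i' j'] inner_disjoint[of i i'] by auto
    then show ?thesis
      using b bij_betw_imp_inj_on[OF inner_label[of i]] by (auto simp: inj_on_def)
  qed
qed

lemma label_f:
  assumes "i < M"
  shows "f i = label ` ({(i, 0), (Suc i, 0)} \<union> {i} \<times> {1..<k - 1})"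
proof -
  have "{i} \<times> {1..<k - 1} = Pair i ` {1..<k - 1}" by auto
  then have "label ` ({i} \<times> {1..<k - 1}) = inner_label i ` {1..<k - 1}"
    by (simp only: image_image) (intro image_cong, auto simp: label_def)
  then have "label ` ({i} \<times> {1..<k - 1}) = inner i"
    using bij_betw_imp_surj_on[OF inner_label[OF assms]] by simp
  then show ?thesis
    unfolding image_Un using pos_f[OF assms] by (auto simp: inner_def label_def)
qed

text \<open>The \<open>M + 1\<close> joints and the \<open>M\<close> edges need different index
  reversals. Keeping \<open>j\<close> matches the inner vertices of mirrored edges through their
  enumerations.\<close>

definition mirror :: "nat \<times> nat \<Rightarrow> nat \<times> nat" where
  "mirror = (\<lambda>(i, j). (if j = 0 then M - i else M - 1 - i, j))"

definition reflection :: "'b \<Rightarrow> 'b" where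
  "reflection w = (if w \<in> label ` index then label (mirror (inv_into index label w)) else w)"

text \<open>For a joint the condition is \<open>i < M - i\<close>. An inner vertex belongs to the
  edge \<open>i\<close>, whose mirror has index \<open>M - 1 - i\<close>, which accounts for the
  additional 1.\<close>

definition left_half :: "'b set" where
  "left_half = label ` {(i, j) \<in> index. 2 * i + (if j = 0 then 0 else 1) < M}"

lemma reflection_label: "z \<in> index \<Longrightarrow> reflection (label z) = label (mirror z)"
  by (simp add: reflection_def inj_label)

lemma mirror_index: "z \<in> index \<Longrightarrow> mirror z \<in> index"
  by (auto simp: mirror_def index_def)

lemma mirror_mirror: "z \<in> index \<Longrightarrow> mirror (mirror z) = z"
  by (auto simp: mirror_def index_def)

lemma label_left_half:
  "(i, j) \<in> index \<Longrightarrow> label (i, j) \<in> left_half \<longleftrightarrow> 2 * i + (if j = 0 then 0 else 1) < M"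
  unfolding left_half_def using inj_label
  by (subst inj_on_image_mem_iff[OF inj_label]) auto

lemma label_index_cases:
  assumes "w \<in> label ` index"
  obtains i i' j where "w = label (i, j)" "(i, j) \<in> index" "(i', j) \<in> index"
    "reflection w = label (i', j)" "i' + i + (if j = 0 then 0 else 1) = M"
proof -
  obtain i j where z: "w = label (i, j)" "(i, j) \<in> index" using assms by auto
  show thesis
  proof (rule that[OF z, of "fst (mirror (i, j))"])
    show "(fst (mirror (i, j)), j) \<in> index"
      using mirror_index[OF z(2)] by (simp add: mirror_def)
    show "reflection w = label (fst (mirror (i, j)), j)"
      using reflection_label[OF z(2)] z(1) by (simp add: mirror_def)
    show "fst (mirror (i, j)) + i + (if j = 0 then 0 else 1) = M"
      using z(2) by (auto simp: mirror_def index_def)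
  qed
qed

sublocale polarization reflection left_half
proof
  fix w
  show "reflection (reflection w) = w"
    by (cases "w \<in> label ` index")
      (auto simp: reflection_label mirror_index mirror_mirror, simp add: reflection_def)
  show "w \<in> left_half \<Longrightarrow> reflection w \<notin> left_half"
  proof -
    assume w: "w \<in> left_half"
    then have "w \<in> label ` index" by (auto simp: left_half_def)
    then show ?thesis
      by (rule label_index_cases) (use w in \<open>auto simp: label_left_half split: if_splits\<close>)
  qed
  assume ne: "reflection w \<noteq> w"
  then have "w \<in> label ` index" by (metis reflection_def)
  then show "w \<in> left_half \<or> reflection w \<in> left_half"
  proof (rule label_index_cases)
    fix i i' j
    assume *: "w = label (i, j)" "(i, j) \<in> index" "(i', j) \<in> index"
      "reflection w = label (i', j)" "i' + i + (if j = 0 then 0 else 1) = M"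
    then have "i \<noteq> i'" using ne by auto
    then have "2 * i + (if j = 0 then 0 else 1) < M \<or> 2 * i' + (if j = 0 then 0 else 1) < M"
      using *(5) by linarith
    then show ?thesis using * by (simp add: label_left_half)
  qed
qed

lemma reflection_pos: "i \<le> M \<Longrightarrow> reflection (pos i) = pos (M - i)"
  using reflection_label[of "(i, 0)"] by (simp add: index_def mirror_def label_def)

lemma reflection_f: "i < M \<Longrightarrow> reflection ` f i = f (M - 1 - i)"
proof -
  assume i: "i < M"
  let ?A = "\<lambda>i. {(i, 0), (Suc i, 0)} \<union> {i} \<times> {1..<k - 1}"
  have sub: "?A i \<subseteq> index" using i by (auto simp: index_def)
  have "reflection ` f i = (\<lambda>z. label (mirror z)) ` ?A i"
    unfolding label_f[OF i] image_image using sub by (intro image_cong refl reflection_label) auto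
  also have "\<dots> = label ` mirror ` ?A i" by (simp only: image_image)
  also have "mirror ` ?A i = ?A (M - 1 - i)"
  proof -
    have "M - i = Suc (M - 1 - i)" using i by simp
    then have "mirror ` {(i, 0), (Suc i, 0)} = {(M - 1 - i, 0), (Suc (M - 1 - i), 0)}"
      by (auto simp: mirror_def)
    moreover have "mirror ` ({i} \<times> {1..<k - 1}) = (\<lambda>z. (M - 1 - i, snd z)) ` ({i} \<times> {1..<k - 1})"
      by (intro image_cong) (auto simp: mirror_def)
    moreover have "\<dots> = {M - 1 - i} \<times> {1..<k - 1}"
      by (auto simp: image_iff)
    ultimately show ?thesis unfolding image_Un by simp
  qed
  finally show ?thesis using label_f[of "M - 1 - i"] i by simp
qed

lemma reflection_outside:
  assumes "w \<notin> pos ` {..M}" "w \<notin> (\<Union>i<M. f i)"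
  shows "reflection w = w"
proof -
  have "w \<notin> label ` index"
  proof
    assume "w \<in> label ` index"
    then obtain i j where "(i, j) \<in> index" "w = label (i, j)" by auto
    then show False
      using assms inner_label_mem[of i j] by (cases "j = 0") (auto simp: index_def label_def inner_def)
  qed
  then show ?thesis by (simp add: reflection_def)
qed

lemma pos_left_half: "2 * i < M \<Longrightarrow> pos i \<in> left_half"
  using label_left_half[of i 0] by (simp add: index_def label_def)

lemma pos_closed_half: "2 * i \<le> M \<Longrightarrow> pos i \<in> closed_half"
  using pos_left_half[of i] reflection_pos[of i]
  by (cases "2 * i = M") (auto simp: closed_half_def)

text \<open>The right end of the edge may be the centre itself; it is then a fixed point, which is
  why the closed half appears.\<close>

lemma f_closed_half:
  assumes "2 * Suc i \<le> M"
  shows "f i \<subseteq> closed_half"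
proof -
  have "label (i, j) \<in> left_half" if "j \<in> {1..<k - 1}" for j
    using that assms label_left_half[of i j] by (simp add: index_def)
  moreover have "pos i \<in> closed_half" "pos (Suc i) \<in> closed_half"
    using assms by (auto intro!: pos_closed_half)
  moreover have "f i = {label (i, 0), label (Suc i, 0)} \<union> (\<lambda>j. label (i, j)) ` {1..<k - 1}"
    using label_f[of i] assms by (auto simp: image_Un image_iff)
  moreover have "label (i, 0) = pos i" "label (Suc i, 0) = pos (Suc i)"
    by (simp_all add: label_def)
  moreover have "left_half \<subseteq> closed_half" by (auto simp: closed_half_def)
  ultimately show ?thesis by auto
qed

text \<open>Only the middle edge of a line of odd length has vertices on both sides of the centre,
  and the reflection maps it to itself.\<close>

lemma polarized_edge_f: "i < M \<Longrightarrow> polarized_edge (f i)"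
proof -
  assume i: "i < M"
  have "2 * Suc i \<le> M \<or> 2 * Suc (M - 1 - i) \<le> M \<or> M - 1 - i = i"
    using i by presburger
  then consider "2 * Suc i \<le> M" | "2 * Suc (M - 1 - i) \<le> M" | "M - 1 - i = i"
    by blast
  then show ?thesis
    using f_closed_half[of i] f_closed_half[of "M - 1 - i"] reflection_f[OF i]
    by cases (auto simp: polarized_edge_def)
qed

lemma reflection_edges: "(`) reflection ` f ` {..<M} = f ` {..<M}"
proof -
  have "(`) reflection ` f ` {..<M} = (\<lambda>i. f (M - 1 - i)) ` {..<M}"
    unfolding image_image using reflection_f by (intro image_cong) auto
  also have "\<dots> = f ` (\<lambda>i. M - 1 - i) ` {..<M}" by (simp only: image_image)
  also have "(\<lambda>i. M - 1 - i) ` {..<M} = {..<M}"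
  proof (intro set_eqI iffI)
    fix i assume "i \<in> {..<M}"
    then show "i \<in> (\<lambda>i. M - 1 - i) ` {..<M}" by (intro image_eqI[of _ _ "M - 1 - i"]) auto
  qed auto
  finally show ?thesis .
qed

end

section \<open>Moving a pendant edge\<close>

definition add_pendant_edge :: "'b hypergraph \<Rightarrow> 'b \<Rightarrow> 'b set \<Rightarrow> 'b hypergraph" where
  "add_pendant_edge C a N = Hypergraph (verts C \<union> N) (insert (insert a N) (edges C))"

lemma add_pendant_edge_simps [simp]:
  "verts (add_pendant_edge C a N) = verts C \<union> N"
  "edges (add_pendant_edge C a N) = insert (insert a N) (edges C)"
  by (simp_all add: add_pendant_edge_def)

lemma uniform_add_pendant_edge:
  assumes "uniform_hypergraph k C" "a \<in> verts C" "N \<inter> verts C = {}" "card N = k - 1" "k \<ge> 2"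
  shows "uniform_hypergraph k (add_pendant_edge C a N)"
proof -
  have "finite N" using assms(4,5) card_ge_0_finite[of N] by simp
  moreover have "a \<notin> N" using assms by auto
  ultimately show ?thesis
    using assms unfolding uniform_hypergraph_def by auto
qed

lemma pendant_edge_notin:
  assumes "uniform_hypergraph k C" "N \<inter> verts C = {}" "N \<noteq> {}"
  shows "insert a N \<notin> edges C"
proof
  assume "insert a N \<in> edges C"
  then have "insert a N \<subseteq> verts C"
    using assms(1) unfolding uniform_hypergraph_def by blast
  then show False using assms(2,3) by auto
qed

lemma energy_add_pendant_edge:
  assumes "uniform_hypergraph k C" "N \<inter> verts C = {}" "N \<noteq> {}"
  shows "energy \<alpha> k (edges (add_pendant_edge C a N)) x
    = energy \<alpha> k (edges C) x + edge_energy \<alpha> k x (insert a N)"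
  using pendant_edge_notin[OF assms, of a] finite_edges[OF assms(1)] by (simp add: energy_def)

lemma vertex_form_add_pendant_edge:
  fixes x :: "'b \<Rightarrow> real"
  assumes "uniform_hypergraph k C" "N \<inter> verts C = {}" "N \<noteq> {}" "w \<in> verts C"
  shows "vertex_form \<alpha> k (edges (add_pendant_edge C a N)) x w = vertex_form \<alpha> k (edges C) x w
    + (if w = a then \<alpha> * x w ^ (k - 1) + (1 - \<alpha>) * prod x N else 0)"
proof (cases "w = a")
  case True
  then have "{e \<in> edges (add_pendant_edge C a N). w \<in> e}
      = insert (insert a N) {e \<in> edges C. w \<in> e}" by auto
  moreover have "insert a N - {w} = N" using True assms by auto
  ultimately show ?thesis
    using True pendant_edge_notin[OF assms(1-3), of a] finite_edges[OF assms(1)]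
    unfolding vertex_form_def by simp
next
  case False
  then have "{e \<in> edges (add_pendant_edge C a N). w \<in> e} = {e \<in> edges C. w \<in> e}"
    using assms by auto
  then show ?thesis using False unfolding vertex_form_def by simp
qed

lemma prod_eq_imp_eq:
  fixes x y :: "'b \<Rightarrow> real"
  assumes "finite A" and pos: "\<And>w. w \<in> A \<Longrightarrow> 0 < x w" and le: "\<And>w. w \<in> A \<Longrightarrow> x w \<le> y w"
    and eq: "prod x A = prod y A" and "v \<in> A"
  shows "x v = y v"
proof (rule ccontr)
  assume "x v \<noteq> y v"
  then have "x v < y v" using le[OF \<open>v \<in> A\<close>] by simp
  moreover have "prod x (A - {v}) \<le> prod y (A - {v})"
    using pos le by (intro prod_mono) (auto simp: less_imp_le)
  moreover have "0 < prod x (A - {v})" using pos by (intro prod_pos) auto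
  ultimately have "x v * prod x (A - {v}) < y v * prod y (A - {v})"
    using pos[OF \<open>v \<in> A\<close>] by (intro mult_less_le_imp_less) auto
  then show False using eq prod.remove[OF \<open>finite A\<close> \<open>v \<in> A\<close>, of x]
      prod.remove[OF \<open>finite A\<close> \<open>v \<in> A\<close>, of y] by simp
qed

text \<open>Both terms of the energy are monotone, so equal energies leave the product no room to
  grow; \<alpha> \<open>< 1\<close> gives that product a positive weight.\<close>

lemma edge_energy_eq_imp_eq:
  assumes "finite e" "\<And>w. w \<in> e \<Longrightarrow> 0 < x w" "\<And>w. w \<in> e \<Longrightarrow> x w \<le> y w"
    and \<alpha>: "0 \<le> \<alpha>" "\<alpha> < 1" and "k \<ge> 1"
    and eq: "edge_energy \<alpha> k x e = edge_energy \<alpha> k y e" and "v \<in> e"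
  shows "x v = y v"
proof (rule prod_eq_imp_eq[of e])
  have "\<alpha> * (\<Sum>w\<in>e. x w ^ k) \<le> \<alpha> * (\<Sum>w\<in>e. y w ^ k)"
    using assms by (intro mult_left_mono sum_mono power_mono) (auto simp: less_imp_le)
  then have "(1 - \<alpha>) * (real k * prod y e) \<le> (1 - \<alpha>) * (real k * prod x e)"
    using eq by (simp add: edge_energy_def)
  then have "prod y e \<le> prod x e" using \<alpha> \<open>k \<ge> 1\<close> by simp
  moreover have "prod x e \<le> prod y e"
    using assms by (intro prod_mono) (auto simp: less_imp_le)
  ultimately show "prod x e = prod y e" by simp
qed (use assms in auto)

context polarization
begin

text \<open>This allows the eigenvalue equations at \<open>w\<close> before and after polarization
  to be compared term by term. An edge in the opposite closed half cannot contain \<open>w\<close>,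
  and in an invariant edge the unchanged factor \<open>x w\<close> cancels from two equal
  products.\<close>

lemma polarize_link_le:
  assumes w: "w \<in> P" "w \<in> e" "polarize x w = x w" and e: "polarized_edge e" "finite e"
    and pos: "\<And>w. 0 < x w"
  shows "(\<Prod>z\<in>e - {w}. x z) \<le> (\<Prod>z\<in>e - {w}. polarize x z)"
proof -
  consider "e \<subseteq> closed_half" | "\<sigma> ` e \<subseteq> closed_half" | "\<sigma> ` e = e"
    using e by (auto simp: polarized_edge_def)
  then show ?thesis
  proof cases
    case 1
    then show ?thesis
      using pos by (intro prod_mono) (auto simp: less_imp_le intro!: polarize_ge)
  next
    case 2
    then have "\<sigma> w \<in> closed_half" using w by auto
    then show ?thesis using half[OF w(1)] w(1) by (auto simp: closed_half_def inv)
  next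
    case 3
    have "x w * (\<Prod>z\<in>e - {w}. x z) = x w * (\<Prod>z\<in>e - {w}. polarize x z)"
      using prod_polarize_invariant[OF 3, of x] pos w e(2) prod.remove[OF e(2) w(2), of x]
        prod.remove[OF e(2) w(2), of "polarize x"] by (metis less_imp_le)
    then show ?thesis using pos[of w] by simp
  qed
qed

end

context loose_line
begin

text \<open>
  If the two spectral radii were not in this order, then the polarized Perron vector would be an
  eigenvector for the same eigenvalue. It agrees with the original one at an end of some edge
  off the line, and the eigenvalue equations propagate the agreement to \<open>pos 0\<close>, where
  the additional edge makes them contradictory.
\<close>
lemma spectral_radius_move_pendant_edge:
  fixes C :: "'b hypergraph"
  assumes C: "uniform_hypergraph k C" and \<alpha>: "0 \<le> \<alpha>" "\<alpha> < 1" and M: "0 < M"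
    and f: "\<And>i. i < M \<Longrightarrow> f i \<in> edges C"
    and off: "\<And>e w. e \<in> edges C \<Longrightarrow> e \<notin> f ` {..<M} \<Longrightarrow> w \<in> e \<Longrightarrow> w \<in> (\<Union>i<M. f i) \<Longrightarrow>
        \<exists>i. w = pos i \<and> 2 * i \<le> M"
    and b: "2 * b < M" "e0 \<in> edges C" "e0 \<notin> f ` {..<M}" "pos b \<in> e0"
    and N: "N \<inter> verts C = {}" "card N = k - 1" and N': "N' \<inter> verts C = {}" "card N' = k - 1"
    and con: "connected_hypergraph (add_pendant_edge C (pos M) N)"
      "connected_hypergraph (add_pendant_edge C (pos 0) N')"
  shows "alpha_spectral_radius k \<alpha> (add_pendant_edge C (pos M) N)
    < alpha_spectral_radius k \<alpha> (add_pendant_edge C (pos 0) N')"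
proof (rule ccontr)
  let ?H = "add_pendant_edge C (pos M) N" and ?H' = "add_pendant_edge C (pos 0) N'"
  let ?V = "verts C" and ?E = "edges C"
  define r where "r = alpha_spectral_radius k \<alpha> ?H"
  define r' where "r' = alpha_spectral_radius k \<alpha> ?H'"
  assume "\<not> alpha_spectral_radius k \<alpha> ?H < alpha_spectral_radius k \<alpha> ?H'"
  then have r: "r' \<le> r" by (simp add: r_def r'_def)
  have fV: "f i \<subseteq> ?V" if "i < M" for i
    using f[OF that] C unfolding uniform_hypergraph_def by blast
  have posV: "pos i \<in> ?V" if "i \<le> M" for i
  proof (cases "i = M")
    case True
    then show ?thesis using pos_f(2)[of "M - 1"] fV[of "M - 1"] M by auto
  next
    case False
    then show ?thesis using pos_f(1)[of i] fV[of i] that by auto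
  qed
  have fin: "finite ?V" "finite ?E" using C finite_edges[OF C] by (auto simp: uniform_hypergraph_def)
  have fine: "finite e" if "e \<in> ?E" for e
    using that C fin finite_subset unfolding uniform_hypergraph_def by blast
  have finN: "finite N" "finite N'" "N \<noteq> {}" "N' \<noteq> {}"
    using N N' k card_ge_0_finite[of N] card_ge_0_finite[of N'] by auto
  have unif: "uniform_hypergraph k ?H" "uniform_hypergraph k ?H'"
    using uniform_add_pendant_edge[OF C] posV N N' k by auto
  have ne: "verts ?H \<noteq> {}" "verts ?H' \<noteq> {}" using finN by auto
  have k1: "k \<ge> 1" using k by simp
  obtain x0 where x0: "\<forall>w\<in>verts ?H. 0 < x0 w"
    "energy \<alpha> k (edges ?H) x0 = r * (\<Sum>w\<in>verts ?H. x0 w ^ k)"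
    using alpha_spectral_radius_attained[OF unif(1) con(1) k ne(1) \<alpha>] unfolding r_def by blast
  \<comment> \<open>The value 1 outside the hypergraph makes the vector positive everywhere, as the
    polarization lemmas ask.\<close>
  define x where "x w = (if w \<in> verts ?H then x0 w else 1)" for w
  have pos: "0 < x w" for w using x0 by (simp add: x_def)
  have "energy \<alpha> k (edges ?H) x = energy \<alpha> k (edges ?H) x0"
    by (rule energy_cong[OF unif(1)]) (simp add: x_def)
  moreover have "(\<Sum>w\<in>verts ?H. x w ^ k) = (\<Sum>w\<in>verts ?H. x0 w ^ k)"
    by (rule sum.cong) (auto simp: x_def)
  ultimately have xr: "energy \<alpha> k (edges ?H) x = r * (\<Sum>w\<in>verts ?H. x w ^ k)"
    using x0 by simp
  have xeq: "vertex_form \<alpha> k (edges ?H) x w = r * x w ^ (k - 1)" if "w \<in> verts ?H" for w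
    by (rule maximizer_vertex_form[OF unif(1) k1 pos that xr])
      (use alpha_spectral_radius_bound[OF unif(1) con(1) k ne(1) \<alpha>] in \<open>simp add: r_def\<close>)
  obtain \<beta> where \<beta>: "bij_betw \<beta> N' N"
    using finite_same_card_bij[OF finN(2,1)] N N' by auto
  define z where "z = polarize x"
  define y where "y w = (if w \<in> N' then x (\<beta> w) else z w)" for w
  have zpos: "0 < z w" for w unfolding z_def using pos by (intro polarize_pos)
  have ypos: "0 < y w" for w using pos zpos by (simp add: y_def)
  have yz: "y w = z w" if "w \<in> ?V" for w using that N' by (auto simp: y_def)
  have yN': "(\<Sum>w\<in>N'. y w ^ k) = (\<Sum>w\<in>N. x w ^ k)" "(\<Prod>w\<in>N'. y w) = (\<Prod>w\<in>N. x w)"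
    using sum.reindex_bij_betw[OF \<beta>, of "\<lambda>w. x w ^ k"] prod.reindex_bij_betw[OF \<beta>, of x]
    by (simp_all add: y_def)
  have fixed: "reflection w = w" if "w \<notin> ?V" for w
    using that fV posV by (intro reflection_outside) auto
  have V_inv: "reflection ` ?V = ?V"
  proof -
    have "reflection w \<in> ?V" if "w \<in> ?V" for w
      using fixed[of "reflection w"] that by (metis inv)
    then show ?thesis by (metis image_image_reflection image_mono image_subset_iff subset_antisym)
  qed
  have norms: "(\<Sum>w\<in>verts ?H'. y w ^ k) = (\<Sum>w\<in>verts ?H. x w ^ k)"
  proof -
    have "(\<Sum>w\<in>verts ?H'. y w ^ k) = (\<Sum>w\<in>?V. y w ^ k) + (\<Sum>w\<in>N'. y w ^ k)"
      using fin finN N' by (auto intro!: sum.union_disjoint)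
    also have "(\<Sum>w\<in>?V. y w ^ k) = (\<Sum>w\<in>?V. x w ^ k)"
      using sum_power_polarize_invariant[OF V_inv, of x k] by (simp add: yz flip: z_def)
    also have "\<dots> + (\<Sum>w\<in>N'. y w ^ k) = (\<Sum>w\<in>verts ?H. x w ^ k)"
      unfolding yN' using fin finN N by (auto intro!: sum.union_disjoint[symmetric])
    finally show ?thesis .
  qed
  let ?A = "f ` {..<M}" and ?B = "?E - f ` {..<M}"
  have split: "energy \<alpha> k ?E t = energy \<alpha> k ?A t + energy \<alpha> k ?B t" for t
  proof -
    have "?A \<subseteq> ?E" using f by auto
    then show ?thesis
      using sum.subset_diff[of ?A ?E "edge_energy \<alpha> k t"] fin by (simp add: energy_def)
  qed
  \<comment> \<open>A vertex of such an edge is either a joint not beyond the centre, by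
    \<open>off\<close>, or not on the line at all and hence fixed.\<close>
  have B_half: "e \<subseteq> closed_half" if eB: "e \<in> ?B" for e
  proof
    fix w assume w: "w \<in> e"
    show "w \<in> closed_half"
    proof (cases "w \<in> (\<Union>i<M. f i)")
      case True
      then obtain i where "w = pos i" "2 * i \<le> M" using off[of e w] eB w by auto
      then show ?thesis using pos_closed_half by simp
    next
      case False
      have "w \<notin> pos ` {..M}"
      proof
        assume "w \<in> pos ` {..M}"
        then obtain i where i: "w = pos i" "i \<le> M" by auto
        then show False
          using False pos_f(1)[of i] pos_f(2)[of "i - 1"] M by (cases "i = M") auto
      qed
      then show ?thesis using reflection_outside[OF _ False] by (simp add: closed_half_def)
    qed
  qed
  have E_pol: "polarized_edge e" if "e \<in> ?E" for e
    using that B_half[of e] polarized_edge_f by (auto simp: polarized_edge_def)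
  have A_le: "energy \<alpha> k ?A x \<le> energy \<alpha> k ?A z"
    unfolding z_def
    by (rule energy_polarize[OF _ reflection_edges]) (use polarized_edge_f finite_f pos \<alpha> in \<open>auto simp: less_imp_le\<close>)
  have B_edge_le: "edge_energy \<alpha> k x e \<le> edge_energy \<alpha> k z e" if "e \<in> ?B" for e
    unfolding z_def using B_half[OF that] pos \<alpha> by (intro edge_energy_half) (auto simp: less_imp_le)
  \<comment> \<open>\<open>pos 0\<close> receives the larger of the entries at \<open>pos 0\<close>
    and \<open>pos M\<close>, and the entries on \<open>N\<close> are carried over to
    \<open>N'\<close> unchanged.\<close>
  have new_le: "edge_energy \<alpha> k x (insert (pos M) N) \<le> edge_energy \<alpha> k y (insert (pos 0) N')"
  proof -
    have "x (pos M) \<le> y (pos 0)"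
      using polarize_half[OF pos_closed_half, of 0 x] reflection_pos[of 0] yz[OF posV[of 0]]
      by (simp add: z_def)
    moreover have "pos M \<notin> N" "pos 0 \<notin> N'" using posV N N' by blast+
    ultimately show ?thesis
      using finN \<alpha> pos[of "pos M"] pos unfolding edge_energy_def
      by (simp add: yN') (intro add_mono mult_left_mono mult_right_mono power_mono prod_nonneg;
          simp add: less_imp_le)
  qed
  have E_yz: "energy \<alpha> k ?E y = energy \<alpha> k ?E z"
    by (rule energy_cong[OF C]) (rule yz)
  \<comment> \<open>With \<open>A_le\<close>, \<open>B_le\<close> and \<open>new_le\<close> this
    closes a circle of inequalities, so all of them are equalities. In particular \<open>y\<close>
    is a maximizer for \<open>?H'\<close>, and the energy of the edges off the line has not
    grown.\<close>
  have chain: "energy \<alpha> k (edges ?H') y \<le> r' * (\<Sum>w\<in>verts ?H'. y w ^ k)"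
    "r' * (\<Sum>w\<in>verts ?H'. y w ^ k) \<le> energy \<alpha> k (edges ?H) x"
    unfolding xr norms
    using alpha_spectral_radius_bound[OF unif(2) con(2) k ne(2) \<alpha>, of y] ypos r pos norms
    by (auto simp: r'_def less_imp_le intro!: mult_right_mono sum_nonneg)
  have total: "energy \<alpha> k (edges ?H) x
      = energy \<alpha> k ?A x + energy \<alpha> k ?B x + edge_energy \<alpha> k x (insert (pos M) N)"
    "energy \<alpha> k (edges ?H') y
      = energy \<alpha> k ?A z + energy \<alpha> k ?B z + edge_energy \<alpha> k y (insert (pos 0) N')"
    unfolding energy_add_pendant_edge[OF C N(1) finN(3)] energy_add_pendant_edge[OF C N'(1) finN(4)]
      E_yz by (simp_all add: split)
  have B_le: "energy \<alpha> k ?B x \<le> energy \<alpha> k ?B z"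
    unfolding energy_def by (rule sum_mono) (rule B_edge_le)
  have yr: "energy \<alpha> k (edges ?H') y = r' * (\<Sum>w\<in>verts ?H'. y w ^ k)" and "energy \<alpha> k ?B x = energy \<alpha> k ?B z"
    and "energy \<alpha> k (edges ?H) x = r' * (\<Sum>w\<in>verts ?H'. y w ^ k)"
    using chain total A_le B_le new_le by linarith+
  then have rr: "r * (\<Sum>w\<in>verts ?H. x w ^ k) = r' * (\<Sum>w\<in>verts ?H. x w ^ k)"
    unfolding xr norms by simp
  have "(\<Sum>w\<in>verts ?H. x w ^ k) > 0"
    using unif(1) ne(1) pos by (intro sum_pos) (auto simp: uniform_hypergraph_def)
  then have r_eq: "r' = r" using rr by simp
  have yeq: "vertex_form \<alpha> k (edges ?H') y w = r * y w ^ (k - 1)" if "w \<in> verts ?H'" for w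
    unfolding r_eq[symmetric]
    by (rule maximizer_vertex_form[OF unif(2) k1 ypos that yr])
      (use alpha_spectral_radius_bound[OF unif(2) con(2) k ne(2) \<alpha>] in \<open>simp add: r'_def\<close>)
  have e0: "e0 \<in> ?B" using b by simp
  have "edge_energy \<alpha> k x e0 = edge_energy \<alpha> k z e0"
  proof (rule ccontr)
    assume "edge_energy \<alpha> k x e0 \<noteq> edge_energy \<alpha> k z e0"
    then have "edge_energy \<alpha> k x e0 < edge_energy \<alpha> k z e0" using B_edge_le[OF e0] by simp
    then have "energy \<alpha> k ?B x < energy \<alpha> k ?B z"
      unfolding energy_def using fin e0 B_edge_le by (intro sum_strict_mono_ex1) auto
    then show False using \<open>energy \<alpha> k ?B x = energy \<alpha> k ?B z\<close> by simp
  qed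
  then have start: "z (pos b) = x (pos b)"
    using edge_energy_eq_imp_eq[of e0 x z \<alpha> k "pos b"] fine[OF b(2)] pos \<alpha> k1 b(4)
      B_half[OF e0] polarize_ge unfolding z_def by (metis subsetD)
  \<comment> \<open>At \<open>w\<close> the right-hand sides of the two eigenvalue equations agree.
    On the left, no link product drops under polarization, and the new edge contributes a positive
    term if \<open>w = pos 0\<close>. Hence \<open>w\<close> is not \<open>pos 0\<close> and every
    link product is preserved, which preserves each entry on an edge within the closed half.\<close>
  have step: "w \<noteq> pos 0 \<and> (\<forall>e\<in>?E. w \<in> e \<longrightarrow> e \<subseteq> closed_half \<longrightarrow> (\<forall>w'\<in>e. z w' = x w'))"
    if w: "w \<in> left_half" "w \<in> ?V" "z w = x w" for w
  proof -
    \<comment> \<open>Hence the edge added to \<open>?H\<close> does not enter the equation of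
      \<open>x\<close> at \<open>w\<close>.\<close>
    have "pos M \<notin> left_half"
      using half[OF pos_left_half[of 0]] M reflection_pos[of 0] by simp
    then have "w \<noteq> pos M" using w by auto
    have yw: "y w = x w" using yz w by simp
    let ?S = "{e \<in> ?E. w \<in> e}"
    let ?T = "\<lambda>t e. \<alpha> * x w ^ (k - 1) + (1 - \<alpha>) * (\<Prod>u\<in>e - {w}. t u)"
    have 1: "vertex_form \<alpha> k ?E x w = sum (?T x) ?S" by (simp add: vertex_form_def)
    have 2: "vertex_form \<alpha> k ?E y w = sum (?T z) ?S"
      unfolding vertex_form_def
    proof (rule sum.cong)
      fix e assume "e \<in> ?S"
      then have "e \<subseteq> ?V" using C unfolding uniform_hypergraph_def by blast
      then have "(\<Prod>u\<in>e - {w}. y u) = (\<Prod>u\<in>e - {w}. z u)" using yz by (intro prod.cong) auto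
      then show "of_real \<alpha> * y w ^ (k - 1) + of_real (1 - \<alpha>) * (\<Prod>u\<in>e - {w}. y u) = ?T z e"
        using yw by simp
    qed simp
    have le: "?T x e \<le> ?T z e" if "e \<in> ?S" for e
      using polarize_link_le[OF w(1), of e x] that w(3) E_pol fine pos \<alpha>
      unfolding z_def by (auto intro!: mult_left_mono)
    define g where "g = (if w = pos 0 then \<alpha> * y w ^ (k - 1) + (1 - \<alpha>) * prod y N' else 0)"
    have "sum (?T x) ?S = sum (?T z) ?S + g"
      using xeq[of w] yeq[of w] w(2) \<open>w \<noteq> pos M\<close> yw 1 2
        vertex_form_add_pendant_edge[OF C N(1) finN(3) w(2), of \<alpha> "pos M" x]
        vertex_form_add_pendant_edge[OF C N'(1) finN(4) w(2), of \<alpha> "pos 0" y]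
      unfolding g_def by simp
    moreover have "sum (?T x) ?S \<le> sum (?T z) ?S" by (rule sum_mono) (rule le)
    moreover have "0 \<le> g" "w = pos 0 \<Longrightarrow> 0 < g"
      unfolding g_def using \<alpha> ypos
      by (auto intro!: add_nonneg_pos mult_nonneg_nonneg mult_pos_pos prod_pos add_nonneg_nonneg
          prod_nonneg simp: less_imp_le)
    ultimately have w0: "w \<noteq> pos 0" and eq: "sum (?T x) ?S = sum (?T z) ?S" by auto
    have "z w' = x w'" if e: "e \<in> ?E" "w \<in> e" "e \<subseteq> closed_half" "w' \<in> e" for e w'
    proof -
      have "?T x e = ?T z e"
      proof (rule ccontr)
        assume ne: "?T x e \<noteq> ?T z e"
        have "?T x e < ?T z e" by (rule le_neq_trans[OF le ne]) (use e in simp)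
        then have "sum (?T x) ?S < sum (?T z) ?S"
          using fin le e by (intro sum_strict_mono_ex1) auto
        then show False using eq by simp
      qed
      then have "(\<Prod>u\<in>e - {w}. x u) = (\<Prod>u\<in>e - {w}. z u)" using \<alpha> by simp
      then have "x w' = z w'" if "w' \<noteq> w"
        using prod_eq_imp_eq[of "e - {w}" x z w'] that e fine pos polarize_ge
        unfolding z_def by (metis DiffD1 Diff_iff finite_Diff singletonD subsetD)
      then show ?thesis using w(3) by fastforce
    qed
    then show ?thesis using w0 by blast
  qed
  \<comment> \<open>Agreement moves from \<open>pos b\<close> down to \<open>pos 0\<close>, one edge
    at a time; \<open>2 * b < M\<close> keeps every vertex used in the open half, where
    \<open>step\<close> applies.\<close>
  have "z (pos (b - i)) = x (pos (b - i))" if "i \<le> b" for i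
    using that
  proof (induction i)
    case (Suc i)
    define j where "j = b - Suc i"
    have j: "b - i = Suc j" "Suc j \<le> b" using Suc.prems by (auto simp: j_def)
    have "pos (Suc j) \<in> left_half" "pos (Suc j) \<in> ?V" "z (pos (Suc j)) = x (pos (Suc j))"
      using pos_left_half[of "Suc j"] posV[of "Suc j"] Suc j b by auto
    then show ?case
      using step[of "pos (Suc j)"] f[of j] pos_f[of j] f_closed_half[of j] j b
      unfolding j_def[symmetric] by auto
  qed (use start in simp)
  from this[of b] have "z (pos 0) = x (pos 0)" by simp
  then show False using step[of "pos 0"] pos_left_half[of 0] posV[of 0] M by simp
qed

end

section \<open>Attached paths and internal paths\<close>

text \<open>Distinctness of consecutive joints is part of the definition only at the two ends of the
  path. On an edge in between, equal joints would lie in two edges at distance 2, which are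
  disjoint.\<close>

lemma loose_line_of_path:
  assumes k: "k \<ge> 2" and path: "loose_path k vs es"
  shows "loose_line k (length es) ((!) vs) ((!) es)"
proof -
  have card: "card (es ! i) = k" if "i < length es" for i
    using path that unfolding loose_path_def by simp
  have adj: "es ! i \<inter> es ! (Suc i) = {vs ! Suc i}" if "Suc i < length es" for i
    using path that unfolding loose_path_def by simp
  have disj: "es ! i \<inter> es ! j = {}" if "i + 2 \<le> j" "j < length es" for i j
    using path that unfolding loose_path_def by blast
  have ends: "vs ! 0 \<in> es ! 0 - {vs ! 1}"
    "vs ! length es \<in> es ! (length es - 1) - {vs ! (length es - 1)}" if "0 < length es"
    using path that unfolding loose_path_def by auto
  have l: "vs ! i \<in> es ! i" if "i < length es" for i
  proof (cases i)
    case 0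
    then show ?thesis using ends that by auto
  next
    case (Suc i')
    then show ?thesis using adj[of i'] that by blast
  qed
  have r: "vs ! Suc i \<in> es ! i" if "i < length es" for i
  proof (cases "Suc i < length es")
    case True
    then show ?thesis using adj[of i] by blast
  next
    case False
    then have "length es = Suc i" using that by simp
    then show ?thesis using ends(2) by simp
  qed
  have ne: "vs ! i \<noteq> vs ! Suc i" if i: "i < length es" for i
  proof -
    consider "i = 0" | "Suc i = length es" | i' where "i = Suc i'" "Suc i < length es"
      using i Suc_lessI not0_implies_Suc by metis
    then show ?thesis
    proof cases
      case 1
      then show ?thesis using ends(1) i by auto
    next
      case 2
      then have "length es - 1 = i" "0 < length es" using i by linarith+
      then have "vs ! length es \<noteq> vs ! i" using ends(2) by (metis DiffD2 singletonI)
      then show ?thesis using 2 by metis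
    next
      case 3
      then show ?thesis using r[of i'] l[of "Suc i"] disj[of i' "Suc i"] by auto
    qed
  qed
  show ?thesis
    by unfold_locales (use k card l r ne adj disj in auto)
qed

lemma loose_path_ends:
  assumes "loose_path k vs es"
  shows "vs ! 0 = hd vs" "vs ! length es = last vs"
proof -
  have "length vs = Suc (length es)" using assms by (simp add: loose_path_def)
  moreover from this have "vs \<noteq> []" by auto
  ultimately show "vs ! 0 = hd vs" "vs ! length es = last vs"
    by (auto simp: hd_conv_nth last_conv_nth)
qed

lemma loose_line_branch:
  assumes k: "k \<ge> 2" and c: "c = PathU \<or> c = PathV"
  shows "loose_line k M (branch_vertex c w) (\<lambda>i. branch_edge k c w (Suc i))"
proof -
  have "0 \<in> {..<k - 1}" using k by simp
  moreover have "c i j = c i' j' \<longleftrightarrow> i = i' \<and> j = j'" "c i j \<noteq> Orig x" "Orig x \<noteq> c i j" for i j i' j' x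
    using c by auto
  moreover have "card (branch_edge k c w (Suc i)) = k" for i
  proof -
    have "card (c (Suc i) ` {..<k - 1}) = k - 1"
      using c by (subst card_image) (auto simp: inj_on_def)
    moreover have "branch_vertex c w i \<notin> c (Suc i) ` {..<k - 1}"
      using c by (auto simp: branch_vertex_def)
    ultimately show ?thesis using k by (simp add: branch_edge_def)
  qed
  ultimately show ?thesis
    by unfold_locales (use k in \<open>auto simp: branch_edge_def branch_vertex_def\<close>)
qed

section \<open>Reversing and gluing loose lines\<close>

context loose_line
begin

text \<open>The long line starts at the tip of the path at \<open>v\<close>, so both that path and
  the internal path from \<open>u\<close> to \<open>v\<close> are traversed backwards.\<close>

lemma loose_line_rev: "loose_line k M (\<lambda>i. pos (M - i)) (\<lambda>i. f (M - 1 - i))"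
proof
  fix i assume i: "i < M"
  then have *: "M - i = Suc (M - 1 - i)" "M - Suc i = M - 1 - i" "M - 1 - i < M" by auto
  show "pos (M - i) \<in> f (M - 1 - i)" "pos (M - Suc i) \<in> f (M - 1 - i)" "pos (M - i) \<noteq> pos (M - Suc i)"
    "card (f (M - 1 - i)) = k"
    unfolding *(1,2) using pos_f[OF *(3)] pos_neq[OF *(3)] card_f[OF *(3)] by auto
next
  fix i assume i: "Suc i < M"
  then have *: "M - 1 - i = Suc (M - 1 - Suc i)" "M - Suc i = Suc (M - 1 - Suc i)"
    "Suc (M - 1 - Suc i) < M" by auto
  show "f (M - 1 - i) \<inter> f (M - 1 - Suc i) \<subseteq> {pos (M - Suc i)}"
    unfolding *(1,2) using f_adjacent[OF *(3)] by auto
next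
  fix i j assume "i + 2 \<le> j" "j < M"
  then have "M - 1 - j + 2 \<le> M - 1 - i" "M - 1 - i < M" by arith+
  then show "f (M - 1 - i) \<inter> f (M - 1 - j) = {}"
    using f_disjoint[of "M - 1 - j" "M - 1 - i"] by (simp add: Int_commute)
qed (rule k)

lemma loose_line_append:
  assumes "loose_line k M' pos' f'" and glue: "pos M = pos' 0"
    and Int: "\<And>i j w. i < M \<Longrightarrow> j < M' \<Longrightarrow> w \<in> f i \<Longrightarrow> w \<in> f' j \<Longrightarrow> w = pos M"
  shows "loose_line k (M + M') (\<lambda>i. if i \<le> M then pos i else pos' (i - M))
    (\<lambda>i. if i < M then f i else f' (i - M))"
proof -
  interpret L': loose_line k M' pos' f' by fact
  \<comment> \<open>The joint lies only in the last edge of the first line and the first edge of the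
    second, so no other edges meet across it.\<close>
  have meet: "Suc i = M \<and> j = 0 \<and> w = pos M" if "i < M" "j < M'" "w \<in> f i" "w \<in> f' j" for i j w
    using Int[OF that] that pos_in_f_iff[of M i] L'.pos_in_f_iff[of 0 j] glue by auto
  have P: "(if i \<le> M then pos i else pos' (i - M)) = pos' (i - M)" if "M \<le> i" for i
    using that glue by auto
  show ?thesis
  proof
    fix i assume i: "i < M + M'"
    show "card (if i < M then f i else f' (i - M)) = k"
      using i card_f[of i] L'.card_f[of "i - M"] by auto
    show "(if i \<le> M then pos i else pos' (i - M)) \<in> (if i < M then f i else f' (i - M))"
      using i pos_f(1)[of i] L'.pos_f(1)[of "i - M"] P[of i] by (cases "i < M") auto
    show "(if Suc i \<le> M then pos (Suc i) else pos' (Suc i - M)) \<in> (if i < M then f i else f' (i - M))"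
      using i pos_f(2)[of i] L'.pos_f(2)[of "i - M"] by (cases "i < M") (auto simp: Suc_diff_le)
    show "(if i \<le> M then pos i else pos' (i - M)) \<noteq> (if Suc i \<le> M then pos (Suc i) else pos' (Suc i - M))"
      using i pos_neq[of i] L'.pos_neq[of "i - M"] P[of i]
      by (cases "i < M") (auto simp: Suc_diff_le)
  next
    fix i assume i: "Suc i < M + M'"
    consider "Suc i < M" | "Suc i = M" | "M \<le> i" by linarith
    then show "(if i < M then f i else f' (i - M)) \<inter> (if Suc i < M then f (Suc i) else f' (Suc i - M))
        \<subseteq> {if Suc i \<le> M then pos (Suc i) else pos' (Suc i - M)}"
    proof cases
      case 1
      then show ?thesis using f_adjacent[of i] by simp
    next
      case 2
      then show ?thesis using meet[of i 0] i by auto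
    next
      case 3
      then show ?thesis using L'.f_adjacent[of "i - M"] i by (simp add: Suc_diff_le less_diff_conv2)
    qed
  next
    fix i j assume ij: "i + 2 \<le> j" "j < M + M'"
    consider "j < M" | "i < M" "M \<le> j" | "M \<le> i" by linarith
    then show "(if i < M then f i else f' (i - M)) \<inter> (if j < M then f j else f' (j - M)) = {}"
    proof cases
      case 1
      then show ?thesis using f_disjoint[of i j] ij by simp
    next
      case 2
      have False if "w \<in> f i" "w \<in> f' (j - M)" for w
      proof -
        have "j - M < M'" using 2 ij by linarith
        then have "Suc i = M \<and> j - M = 0" using meet[OF 2(1) _ that] by simp
        then show False using ij 2 by linarith
      qed
      then show ?thesis using 2 by auto
    next
      case 3
      then have "i - M + 2 \<le> j - M" "j - M < M'" "\<not> i < M" "\<not> j < M" using ij by linarith+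
      then show ?thesis using L'.f_disjoint[of "i - M" "j - M"] by simp
    qed
  qed (rule k)
qed

lemma f_inj: "i < M \<Longrightarrow> j < M \<Longrightarrow> f i = f j \<Longrightarrow> i = j"
  using pos_in_f_iff[of i j] pos_in_f_iff[of j i] pos_f(1)[of i] pos_f(1)[of j] by auto

text \<open>An edge of a loose path contains two distinct joints, and each is an end of the path or
  shared with another of its edges. An edge with at most one such vertex \<open>t\<close> therefore
  cannot occur.\<close>

lemma not_pendant_edge:
  assumes i: "i < M"
    and pendant: "\<And>w. w \<in> f i \<Longrightarrow> w \<noteq> t \<Longrightarrow> w \<noteq> pos 0 \<and> w \<noteq> pos M \<and> (\<forall>j<M. w \<in> f j \<longrightarrow> f j = f i)"
  shows False
proof -
  have "pos i = t"
  proof (rule ccontr)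
    assume t: "pos i \<noteq> t"
    note t = pendant[OF pos_f(1)[OF i] t]
    then obtain i' where i': "i = Suc i'" by (cases i) auto
    then have "i' < M" "pos i \<in> f i'" using i pos_f(2)[of i'] by auto
    then have "f i' = f i" using t by blast
    then show False using f_inj[of i' i] i i' by simp
  qed
  moreover have "pos (Suc i) = t"
  proof (rule ccontr)
    assume t: "pos (Suc i) \<noteq> t"
    note t = pendant[OF pos_f(2)[OF i] t]
    then have "Suc i \<noteq> M" by blast
    then have "Suc i < M" using i by simp
    then have "f (Suc i) = f i" using t pos_f(1) by blast
    then show False using f_inj[of "Suc i" i] i \<open>Suc i < M\<close> by simp
  qed
  ultimately show False using pos_neq[OF i] by simp
qed

end

section \<open>Attached paths built up by pendant edges\<close>

lemma connected_add_pendant_edge: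
  assumes con: "connected_hypergraph C" and a: "a \<in> verts C"
  shows "connected_hypergraph (add_pendant_edge C a N)"
proof -
  let ?H = "add_pendant_edge C a N"
  let ?R = "\<lambda>G. {(a, b). \<exists>e\<in>edges G. a \<in> e \<and> b \<in> e}"
  have mono: "(?R C)\<^sup>* \<subseteq> (?R ?H)\<^sup>*" by (rule rtrancl_mono) auto
  have "(x, a) \<in> (?R ?H)\<^sup>* \<and> (a, x) \<in> (?R ?H)\<^sup>*" if "x \<in> verts ?H" for x
  proof (cases "x \<in> verts C")
    case True
    then show ?thesis using con a mono unfolding connected_hypergraph_def by blast
  next
    case False
    then have "(x, a) \<in> ?R ?H" "(a, x) \<in> ?R ?H" using that by auto
    then show ?thesis by blast
  qed
  then show ?thesis unfolding connected_hypergraph_def by (blast intro: rtrancl_trans)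
qed

lemma attach_paths_Suc_left:
  "attach_paths k G u v (Suc p) q = add_pendant_edge (attach_paths k G u v p q)
    (branch_vertex PathU u p) (PathU (Suc p) ` {..<k - 1})"
proof -
  have "{1..Suc p} = insert (Suc p) {1..p}" by auto
  then show ?thesis
    unfolding attach_paths_def add_pendant_edge_def hypergraph.sel
    by (auto simp: branch_edge_def simp del: One_nat_def)
qed

lemma attach_paths_Suc_right:
  "attach_paths k G u v p (Suc q) = add_pendant_edge (attach_paths k G u v p q)
    (branch_vertex PathV v q) (PathV (Suc q) ` {..<k - 1})"
proof -
  have "{1..Suc q} = insert (Suc q) {1..q}" by auto
  then show ?thesis
    unfolding attach_paths_def add_pendant_edge_def hypergraph.sel
    by (auto simp: branch_edge_def simp del: One_nat_def)
qed

lemma branch_vertex_in_attach_paths: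
  assumes "k \<ge> 2" "u \<in> verts G" "v \<in> verts G"
  shows "branch_vertex PathU u p \<in> verts (attach_paths k G u v p q)"
    and "branch_vertex PathV v q \<in> verts (attach_paths k G u v p q)"
  using assms by (auto simp: branch_vertex_def attach_paths_def)

lemma connected_attach_paths:
  assumes con: "connected_hypergraph G" and uv: "k \<ge> 2" "u \<in> verts G" "v \<in> verts G"
  shows "connected_hypergraph (attach_paths k G u v p q)"
proof (induction p)
  case 0
  show ?case
  proof (induction q)
    case 0
    let ?H = "attach_paths k G u v 0 0"
    have H: "verts ?H = Orig ` verts G" "edges ?H = (`) Orig ` edges G"
      by (auto simp: attach_paths_def)
    have "(Orig x, Orig y) \<in> {(a, b). \<exists>e\<in>edges ?H. a \<in> e \<and> b \<in> e}\<^sup>*"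
      if "(x, y) \<in> {(a, b). \<exists>e\<in>edges G. a \<in> e \<and> b \<in> e}\<^sup>*" for x y
      using that
    proof (induction rule: rtrancl_induct)
      case (step y z)
      then have "(Orig y, Orig z) \<in> {(a, b). \<exists>e\<in>edges ?H. a \<in> e \<and> b \<in> e}"
        unfolding H by blast
      with step.IH show ?case by (rule rtrancl_into_rtrancl)
    qed simp
    then show ?case using con unfolding connected_hypergraph_def H(1) by blast
  next
    case (Suc q)
    then show ?case
      unfolding attach_paths_Suc_right
      by (rule connected_add_pendant_edge) (rule branch_vertex_in_attach_paths(2)[OF uv])
  qed
next
  case (Suc p)
  then show ?case
    unfolding attach_paths_Suc_left
    by (rule connected_add_pendant_edge) (rule branch_vertex_in_attach_paths(1)[OF uv])
qed

text \<open>An attached path of length one is a single edge that touches other edges at most in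
  \<open>Orig u\<close> or \<open>Orig v\<close>. Its new vertices are no ends of the internal path
  either, so \<open>not_pendant_edge\<close> excludes it.\<close>

lemma internal_path_in_base:
  assumes k: "k \<ge> 2" and path: "internal_path k (attach_paths k G u v 1 1) (Orig u) (Orig v) vs es"
  shows "set es \<subseteq> (`) Orig ` edges G"
proof
  let ?H = "attach_paths k G u v 1 1"
  have lp: "loose_path k vs es" and ends: "hd vs = Orig u" "last vs = Orig v"
    and sub: "set es \<subseteq> edges ?H"
    using path by (auto simp: internal_path_def path_hypergraph_def)
  interpret loose_line k "length es" "(!) vs" "(!) es" by (rule loose_line_of_path[OF k lp])
  have pos_ends: "vs ! 0 = Orig u" "vs ! length es = Orig v"
    using ends loose_path_ends[OF lp] by auto
  have H: "edges ?H = (`) Orig ` edges G \<union> {branch_edge k PathU u 1, branch_edge k PathV v 1}"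
    by (auto simp: attach_paths_def)
  fix e assume "e \<in> set es"
  then obtain i where i: "i < length es" "e = es ! i" by (auto simp: in_set_conv_nth)
  have edge: "es ! j \<in> edges ?H" if "j < length es" for j using sub that by auto
  show "e \<in> (`) Orig ` edges G"
  proof (rule ccontr)
    assume "e \<notin> (`) Orig ` edges G"
    then consider "es ! i = branch_edge k PathU u 1" | "es ! i = branch_edge k PathV v 1"
      using edge[OF i(1)] i(2) unfolding H by auto
    then show False
    proof cases
      case 1
      show False
      proof (rule not_pendant_edge[OF i(1), of "Orig u"])
        fix w assume w: "w \<in> es ! i" "w \<noteq> Orig u"
        then obtain j where j: "w = PathU 1 j"
          unfolding 1 by (auto simp: branch_edge_def branch_vertex_def)
        have "e' = es ! i" if "e' \<in> edges ?H" "w \<in> e'" for e'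
          using that unfolding 1 H j by (auto simp: branch_edge_def branch_vertex_def)
        then show "w \<noteq> vs ! 0 \<and> w \<noteq> vs ! length es \<and> (\<forall>j<length es. w \<in> es ! j \<longrightarrow> es ! j = es ! i)"
          using edge by (auto simp: pos_ends j)
      qed
    next
      case 2
      show False
      proof (rule not_pendant_edge[OF i(1), of "Orig v"])
        fix w assume w: "w \<in> es ! i" "w \<noteq> Orig v"
        then obtain j where j: "w = PathV 1 j"
          unfolding 2 by (auto simp: branch_edge_def branch_vertex_def)
        have "e' = es ! i" if "e' \<in> edges ?H" "w \<in> e'" for e'
          using that unfolding 2 H j by (auto simp: branch_edge_def branch_vertex_def)
        then show "w \<noteq> vs ! 0 \<and> w \<noteq> vs ! length es \<and> (\<forall>j<length es. w \<in> es ! j \<longrightarrow> es ! j = es ! i)"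
          using edge by (auto simp: pos_ends j)
      qed
    qed
  qed
qed

text \<open>At any other vertex of the path, an edge outside the path would raise the degree above
  the one within the path.\<close>

lemma internal_path_meets_edge:
  assumes path: "internal_path k H a b vs es" and fin: "finite (edges H)"
    and e: "e \<in> edges H" "e \<notin> set es" and w: "w \<in> e" "w \<in> \<Union>(set es)"
  shows "w = a \<or> w = b"
proof (rule ccontr)
  assume "\<not> ?thesis"
  then have "vertex_degree H w = vertex_degree (path_hypergraph vs es) w"
    using path w unfolding internal_path_def path_hypergraph_def by auto
  moreover have "set es \<subseteq> edges H"
    using path unfolding internal_path_def path_hypergraph_def by simp
  then have "{e \<in> set es. w \<in> e} \<subset> {e \<in> edges H. w \<in> e}"
    using e w by auto
  then have "vertex_degree (path_hypergraph vs es) w < vertex_degree H w"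
    using fin unfolding vertex_degree_def path_hypergraph_def
    by (simp add: psubset_card_mono)
  ultimately show False by simp
qed

theorem theorem4p2:
  fixes k s :: nat and \<alpha> :: real and G :: "'a hypergraph" and u v :: 'a
  assumes "k \<ge> 3" and "0 \<le> \<alpha>" and "\<alpha> < 1"
    and "uniform_hypergraph k G" and "connected_hypergraph G"
    and "u \<in> verts G" and "v \<in> verts G"
    and "vertex_degree G u \<ge> 2" and "vertex_degree G v \<ge> 2"
    and "\<And>p q :: nat. p \<ge> q \<Longrightarrow> q \<ge> 1 \<Longrightarrow>
           \<exists>vs es. internal_path k (attach_paths k G u v p q) (Orig u) (Orig v) vs es \<and> length es = s"
  shows "\<forall>p q :: nat. p \<ge> q \<and> q \<ge> 1 \<and> p - q + 1 \<ge> s \<longrightarrow>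
           alpha_spectral_radius k \<alpha> (attach_paths k G u v (p + 1) (q - 1))
             < alpha_spectral_radius k \<alpha> (attach_paths k G u v p q)"
proof (intro allI impI)
  fix p q' :: nat assume "p \<ge> q' \<and> q' \<ge> 1 \<and> p - q' + 1 \<ge> s"
  \<comment> \<open>With \<open>q\<close> one below the given \<open>q'\<close>, \<open>?C\<close>
    is the common part of both hypergraphs. As \<open>q' \<le> p\<close>, the subtraction is exact
    and its bound becomes \<open>q + s \<le> p\<close>.\<close>
  then obtain q where q: "q' = Suc q" "q < p" "q + s \<le> p" by (cases q') auto
  have k: "k \<ge> 2" using assms(1) by simp
  let ?C = "attach_paths k G u v p q"
  let ?posV = "branch_vertex PathV v" and ?posU = "branch_vertex PathU u"
  let ?fV = "\<lambda>i. branch_edge k PathV v (Suc i)" and ?fU = "\<lambda>i. branch_edge k PathU u (Suc i)"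
  \<comment> \<open>The path for \<open>p = q = 1\<close> consists of edges of \<open>G\<close> by
    \<open>internal_path_in_base\<close>, so it is present in \<open>?C\<close> as well, even when
    \<open>q = 0\<close>.\<close>
  obtain vs es where path: "internal_path k (attach_paths k G u v 1 1) (Orig u) (Orig v) vs es"
    and s: "length es = s"
    using assms(10)[of 1 1] by auto
  have lp: "loose_path k vs es" and "hd vs = Orig u" "last vs = Orig v"
    using path by (auto simp: internal_path_def)
  then have ends: "vs ! 0 = Orig u" "vs ! s = Orig v"
    using loose_path_ends[OF lp] s by auto
  have base: "set es \<subseteq> (`) Orig ` edges G" by (rule internal_path_in_base[OF k path])
  have finH: "finite (edges (attach_paths k G u v 1 1))"
    using finite_edges[OF uniform_attach_paths[OF assms(4) k assms(6,7)]] .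
  interpret V: loose_line k q ?posV ?fV by (rule loose_line_branch[OF k]) simp
  interpret U: loose_line k p ?posU ?fU by (rule loose_line_branch[OF k]) simp
  interpret I: loose_line k s "(!) vs" "(!) es" using loose_line_of_path[OF k lp] s by simp
  have es_Orig: "es ! i \<subseteq> range Orig" if "i < s" for i
  proof -
    have "es ! i \<in> (`) Orig ` edges G" using base nth_mem[of i es] that s by blast
    then show ?thesis by auto
  qed
  have fV_sub: "?fV i \<subseteq> insert (Orig v) (range (case_prod PathV))" for i
    by (auto simp: branch_edge_def branch_vertex_def split: if_splits)
  have fU_sub: "?fU i \<subseteq> insert (Orig u) (range (case_prod PathU))" for i
    by (auto simp: branch_edge_def branch_vertex_def split: if_splits)
  \<comment> \<open>From the tip of the path at \<open>v\<close> back to \<open>v\<close>, reached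
    at index \<open>q\<close>, then along the internal path to \<open>u\<close>, reached at index
    \<open>q + s\<close>.\<close>
  define pos1 where "pos1 = (\<lambda>i. if i \<le> q then ?posV (q - i) else vs ! (s - (i - q)))"
  define f1 where "f1 = (\<lambda>i. if i < q then ?fV (q - 1 - i) else es ! (s - 1 - (i - q)))"
  interpret VI: loose_line k "q + s" pos1 f1
    unfolding pos1_def f1_def
  proof (rule loose_line.loose_line_append[OF V.loose_line_rev I.loose_line_rev])
    show "?posV (q - q) = vs ! (s - 0)" using ends by (simp add: branch_vertex_def)
    fix i j w assume "i < q" "j < s" "w \<in> ?fV (q - 1 - i)" "w \<in> es ! (s - 1 - j)"
    then show "w = ?posV (q - q)"
      using fV_sub[of "q - 1 - i"] es_Orig[of "s - 1 - j"] by (auto simp: branch_vertex_def)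
  qed
  define M where "M = q + s + p"
  define pos where "pos = (\<lambda>i. if i \<le> q + s then pos1 i else ?posU (i - (q + s)))"
  define f where "f = (\<lambda>i. if i < q + s then f1 i else ?fU (i - (q + s)))"
  have pos1_end: "pos1 (q + s) = Orig u"
    using ends by (auto simp: pos1_def branch_vertex_def)
  have f1_sub: "f1 i \<subseteq> range Orig \<union> range (case_prod PathV)" if "i < q + s" for i
  proof (cases "i < q")
    case True
    then show ?thesis using fV_sub[of "q - 1 - i"] unfolding f1_def by auto
  next
    case False
    then have "s - 1 - (i - q) < s" using that by linarith
    then show ?thesis using es_Orig False unfolding f1_def by auto
  qed
  interpret L: loose_line k M pos f
    unfolding pos_def f_def M_def
  proof (rule VI.loose_line_append)
    show "loose_line k p ?posU ?fU" by (rule U.loose_line_axioms)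
    show "pos1 (q + s) = ?posU 0" by (simp add: pos1_end branch_vertex_def)
    fix i j w assume "i < q + s" "j < p" "w \<in> f1 i" "w \<in> ?fU j"
    then show "w = pos1 (q + s)"
      using f1_sub[of i] fU_sub[of j] unfolding pos1_end by auto
  qed
  have pos_v: "pos q = Orig v" by (simp add: pos_def pos1_def branch_vertex_def)
  have pos_u: "pos (q + s) = Orig u" by (simp add: pos_def pos1_end)
  have pos_0: "pos 0 = ?posV q" by (simp add: pos_def pos1_def)
  have pos_M: "pos M = ?posU p"
    using q by (simp add: pos_def M_def)
  have f_edges: "f ` {..<M} = ?fV ` {..<q} \<union> set es \<union> ?fU ` {..<p}"
  proof -
    have "{..<M} = {..<q} \<union> {q..<q + s} \<union> {q + s..<q + s + p}" by (auto simp: M_def)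
    moreover have "f ` {..<q} = ?fV ` {..<q}"
    proof -
      have "f ` {..<q} = ?fV ` (\<lambda>i. q - Suc i) ` {..<q}"
        unfolding image_image by (intro image_cong) (auto simp: f_def f1_def)
      also have "(\<lambda>i. q - Suc i) ` {..<q} = {..<q}"
        by (rule endo_inj_surj) (auto simp: inj_on_def)
      finally show ?thesis .
    qed
    moreover have "f ` {q..<q + s} = set es"
    proof -
      have "f ` {q..<q + s} = (!) es ` (\<lambda>i. s - Suc i) ` (\<lambda>i. i - q) ` {q..<q + s}"
        unfolding image_image by (intro image_cong) (auto simp: f_def f1_def)
      also have "(\<lambda>i. i - q) ` {q..<q + s} = {..<s}"
        by (auto simp: image_iff intro!: bexI[of _ "_ + q"])
      also have "(\<lambda>i. s - Suc i) ` {..<s} = {..<s}"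
        by (rule endo_inj_surj) (auto simp: inj_on_def)
      also have "(!) es ` {..<s} = set es"
        using s by (auto simp: in_set_conv_nth image_iff)
      finally show ?thesis .
    qed
    moreover have "f ` {q + s..<q + s + p} = ?fU ` {..<p}"
    proof -
      have "f ` {q + s..<q + s + p} = ?fU ` (\<lambda>i. i - (q + s)) ` {q + s..<q + s + p}"
        unfolding image_image by (intro image_cong) (auto simp: f_def)
      also have "(\<lambda>i. i - (q + s)) ` {q + s..<q + s + p} = {..<p}"
        by (auto simp: image_iff intro!: bexI[of _ "_ + (q + s)"])
      finally show ?thesis .
    qed
    ultimately show ?thesis by (simp add: image_Un)
  qed
  have C_edges: "edges ?C = (`) Orig ` edges G \<union> ?fU ` {..<p} \<union> ?fV ` {..<q}"
  proof -
    have "{1..n} = Suc ` {..<n}" for n :: nat by (auto simp: image_Suc_lessThan)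
    then show ?thesis by (simp add: attach_paths_def image_image)
  qed
  \<comment> \<open>As an end of the internal path, \<open>v\<close> lies in at most one of its
    edges, so one of two edges of \<open>G\<close> at \<open>v\<close> is off the path.\<close>
  obtain e0 where e0: "e0 \<in> edges G" "v \<in> e0" "Orig ` e0 \<notin> set es"
  proof -
    have "\<not> {e \<in> edges G. v \<in> e} \<subseteq> {e}" for e
      using assms(9) card_mono[of "{e}" "{e \<in> edges G. v \<in> e}"] unfolding vertex_degree_def by auto
    then obtain e1 e2 where e12: "e1 \<in> edges G" "e2 \<in> edges G" "v \<in> e1" "v \<in> e2" "e1 \<noteq> e2"
      by (metis (no_types, lifting) mem_Collect_eq singletonI subsetI)
    have "\<not> (Orig ` e1 \<in> set es \<and> Orig ` e2 \<in> set es)"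
    proof
      assume "Orig ` e1 \<in> set es \<and> Orig ` e2 \<in> set es"
      then obtain i j where ij: "i < s" "j < s" "es ! i = Orig ` e1" "es ! j = Orig ` e2"
        using s by (auto simp: in_set_conv_nth)
      then have "s = Suc i" "s = Suc j"
        using I.pos_in_f_iff[of s i] I.pos_in_f_iff[of s j] e12 ends by auto
      then have "Orig ` e1 = Orig ` e2" using ij by auto
      then show False using e12(5) by (simp add: inj_image_eq_iff inj_def)
    qed
    then show thesis using that e12 by blast
  qed
  \<comment> \<open>Every attached edge contains a new vertex, so an edge of \<open>G\<close> can be
    on the line only through the internal path.\<close>
  have orig_notin: "Orig ` e \<in> f ` {..<M} \<longleftrightarrow> Orig ` e \<in> set es" for e
  proof -
    have "c (Suc i) 0 \<in> branch_edge k c w (Suc i)" for c :: "nat \<Rightarrow> nat \<Rightarrow> 'a attached" and w i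
      using k by (auto simp: branch_edge_def)
    then have "Orig ` e \<noteq> ?fU i" "Orig ` e \<noteq> ?fV i" for i
      by (metis attached.distinct(1) imageE, metis attached.distinct(3) imageE)
    then show ?thesis unfolding f_edges by auto
  qed
  have "alpha_spectral_radius k \<alpha> (add_pendant_edge ?C (pos M) (PathU (Suc p) ` {..<k - 1}))
      < alpha_spectral_radius k \<alpha> (add_pendant_edge ?C (pos 0) (PathV (Suc q) ` {..<k - 1}))"
  proof (rule L.spectral_radius_move_pendant_edge)
    show "uniform_hypergraph k ?C" by (rule uniform_attach_paths[OF assms(4) k assms(6,7)])
    show "0 < M" using q by (simp add: M_def)
    show "f i \<in> edges ?C" if "i < M" for i
    proof -
      have "f ` {..<M} \<subseteq> edges ?C" unfolding f_edges C_edges using base by (simp add: le_supI1 le_supI2)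
      then show ?thesis using that by blast
    qed
    show "\<exists>i. w = pos i \<and> 2 * i \<le> M"
      if e: "e \<in> edges ?C" "e \<notin> f ` {..<M}" "w \<in> e" "w \<in> (\<Union>i<M. f i)" for e w
    proof -
      \<comment> \<open>As \<open>M = q + s + p\<close>, the second inequality is exactly
        \<open>q + s \<le> p\<close>; this is where the lower bound on \<open>p - q'\<close> is
        used.\<close>
      have "2 * q \<le> M" "2 * (q + s) \<le> M" using q by (auto simp: M_def)
      moreover have "w = Orig v \<or> w = Orig u"
      proof -
        obtain e' where e': "e' \<in> edges G" "e = Orig ` e'"
          using e(1,2) unfolding C_edges f_edges by blast
        consider i where "w \<in> ?fV i" | i where "w \<in> ?fU i" | "w \<in> \<Union>(set es)"
          using e(4) unfolding f_edges by blast
        then show ?thesis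
        proof cases
          case 1
          then show ?thesis using fV_sub[of i] e(3) unfolding e'(2) by auto
        next
          case 2
          then show ?thesis using fU_sub[of i] e(3) unfolding e'(2) by auto
        next
          case 3
          have "e \<in> edges (attach_paths k G u v 1 1)" using e' by (simp add: attach_paths_def)
          moreover have "e \<notin> set es" using e(2) unfolding f_edges by blast
          ultimately show ?thesis using internal_path_meets_edge[OF path finH _ _ e(3) 3] by blast
        qed
      qed
      ultimately show ?thesis using pos_u pos_v by metis
    qed
    show "2 * q < M" using q by (simp add: M_def)
    show "Orig ` e0 \<in> edges ?C" using e0 unfolding C_edges by blast
    show "Orig ` e0 \<notin> f ` {..<M}" using e0 orig_notin by simp
    show "pos q \<in> Orig ` e0" using e0 pos_v by simp
    show "PathU (Suc p) ` {..<k - 1} \<inter> verts ?C = {}" "PathV (Suc q) ` {..<k - 1} \<inter> verts ?C = {}"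
      by (auto simp: attach_paths_def)
    show "card (PathU (Suc p) ` {..<k - 1} :: 'a attached set) = k - 1"
      "card (PathV (Suc q) ` {..<k - 1} :: 'a attached set) = k - 1"
      by (simp_all add: card_image inj_on_def)
    show "connected_hypergraph (add_pendant_edge ?C (pos M) (PathU (Suc p) ` {..<k - 1}))"
      using connected_attach_paths[OF assms(5) k assms(6,7), of "Suc p" q]
      by (simp only: attach_paths_Suc_left pos_M)
    show "connected_hypergraph (add_pendant_edge ?C (pos 0) (PathV (Suc q) ` {..<k - 1}))"
      using connected_attach_paths[OF assms(5) k assms(6,7), of p "Suc q"]
      by (simp only: attach_paths_Suc_right pos_0)
  qed (use assms in auto)
  then show "alpha_spectral_radius k \<alpha> (attach_paths k G u v (p + 1) (q' - 1))
      < alpha_spectral_radius k \<alpha> (attach_paths k G u v p q')"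
    using attach_paths_Suc_left[of k G u v p q] attach_paths_Suc_right[of k G u v p q]
    unfolding q pos_M pos_0 by simp
qed

end
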